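(* Let $\Omega=\mathbb{T}^d$, let $h>0$ be fixed, and let $X_N\subset\Omega$, $T_N:\Omega\to X_N$, $\mu$ and $\Delta_N$ be a space discretization as described in the context. Let $u_N^0,\phi_N,\psi_N:X_N\to\{-1,1\}$ together with $u^0,\phi^\Phi,\psi^\Psi:\Omega\to\{-1,1\}$ be given such that $$u_N^0\circ T_N\rightharpoonup u^0,\qquad \phi_N\circ T_N\rightharpoonup\phi^\Phi,\qquad \psi_N\circ T_N\rightharpoonup\psi^\Psi\qquad\text{weakly in }L^2(\Omega)\text{ as }N\to\infty.$$ Let $u_N^\ell:X_N\to\{-1,1\}$ be the iterates of the discrete obstacle MBO scheme $$u_N^{\ell+1}=\mathrm{sign}\big(e^{-h\Delta_N}u_N^\ell+\mathbf 1_{\Phi_N}-\mathbf 1_{\Psi_N}\big)$$ with initial condition $u_N^0$ and obstacles $\phi_N,\psi_N$, and let $u^\ell$ be the iterates of the continuous obstacle MBO scheme $$u^{\ell+1}=\mathrm{sign}\big(e^{-h\Delta}u^\ell+\mathbf 1_{\Phi}-\mathbf 1_{\Psi}\big)$$ with initial condition $u^0$ and obstacles $\Phi,\Psi$. Then, up to subsequences, $$u_N^\ell\circ T_N\rightharpoonup u^\ell\quad\text{weakly in }L^2(\Omega)\text{ for any }\ell\in\mathbb{N}.$$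
   Context: **Discretization.** $X_N\subset\Omega=\mathbb{T}^d$ is a set of $N$ points with empirical measure $\mu_N=\frac1N\sum_{x\in X_N}\delta_x$. There are maps $T_N:\Omega\to X_N$ with $T_N\to\mathrm{id}$ in $L^\infty(\Omega)$ and $\mu_N=(T_N)_\#\mu$ for some measure $\mu=\rho\,\mathcal{L}^d|_\Omega$ with density $\rho>0$ with respect to Lebesgue measure. $\Delta_N$, acting on functions $X_N\to\mathbb{R}$, is a symmetric discretization of the Laplacian $\Delta$ (with the sign convention that $\Delta$ has non-negative eigenvalues) such that $$(e^{-h\Delta_N}v_N)\circ T_N\to e^{-h\Delta}v\ \text{ in }L^2(\Omega)\quad\text{if } v_N\circ T_N\rightharpoonup v\ \text{ weakly in }L^2(\Omega),$$ where $e^{-h\Delta}$ is the heat semigroup at time $h$. **Obstacles.** $\Phi,\Psi\subset\Omega$ are the inner and outer obstacle; with $\Omega_0=\{u^0=1\}$, the sets $\Omega_0$, $\Phi\subset\Omega_0$ and $\Psi\subset\Omega_0^c$ are open and bounded with $W^{2,\infty}$ boundary. $\phi^\Phi=1$ on $\Phi$ and $-1$ off $\Phi$; $\psi^\Psi=-1$ on $\Psi$ and $1$ off $\Psi$. The discrete obstacles $\Phi_N,\Psi_N$ correspond to $\phi_N,\psi_N$ in the same way: $\Phi_N=\{\phi_N=1\}$, $\Psi_N=\{\psi_N=-1\}$. **Notation.** $\mathbf 1_S$ is the $\{0,1\}$-valued indicator function of $S$; $\mathrm{sign}(s)=1$ if $s>0$ and $\mathrm{sign}(s)=-1$ otherwise.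 *)

theory Defs
  imports "HOL-Probability.Probability"
begin

section \<open>The flat torus\<close>

text \<open>
  The torus \<open>\<real>\<^sup>d / \<int>\<^sup>d\<close>, with \<open>d = CARD('d)\<close>, is represented by its half-open fundamental cube.
  Its metric, its topology and the regularity of subsets are those of the quotient: they are
  expressed through the distance modulo \<open>\<int>\<^sup>d\<close> and through periodic preimages in \<open>\<real>\<^sup>d\<close>.
\<close>

definition torus :: "(real ^ 'd) set" where
  "torus = {x. \<forall>i. 0 \<le> x $ i \<and> x $ i < 1}"

definition int_lattice :: "(real ^ 'd) set" where
  "int_lattice = {k. \<forall>i. k $ i \<in> \<int>}"

definition wrap :: "real ^ 'd \<Rightarrow> real ^ 'd" where
  "wrap x = (\<chi> i. frac (x $ i))"

definition torus_dist :: "real ^ 'd \<Rightarrow> real ^ 'd \<Rightarrow> real" where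
  "torus_dist x y = infdist (x - y) int_lattice"

definition lift_set :: "(real ^ 'd) set \<Rightarrow> (real ^ 'd) set" where
  "lift_set S = {x. wrap x \<in> S}"

abbreviation torus_measure :: "(real ^ 'd) measure" where
  "torus_measure \<equiv> lebesgue_on torus"


section \<open>Convergence in \<open>L\<^sup>2\<close>\<close>

definition L2 :: "'a measure \<Rightarrow> ('a \<Rightarrow> real) set" where
  "L2 M = {f \<in> borel_measurable M. integrable M (\<lambda>x. (f x)\<^sup>2)}"

text \<open>
  Membership of the sequence in \<open>L\<^sup>2\<close> is only required eventually: the discretizations
  below are indexed by the number of points, so the index 0 carries no information.
\<close>

definition L2_weakly_converges :: "'a measure \<Rightarrow> (nat \<Rightarrow> 'a \<Rightarrow> real) \<Rightarrow> ('a \<Rightarrow> real) \<Rightarrow> bool" where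
  "L2_weakly_converges M f f0 \<longleftrightarrow>
     (\<forall>\<^sub>F n in sequentially. f n \<in> L2 M) \<and> f0 \<in> L2 M \<and>
     (\<forall>g\<in>L2 M. (\<lambda>n. \<integral>x. f n x * g x \<partial>M) \<longlonglongrightarrow> (\<integral>x. f0 x * g x \<partial>M))"

definition L2_converges :: "'a measure \<Rightarrow> (nat \<Rightarrow> 'a \<Rightarrow> real) \<Rightarrow> ('a \<Rightarrow> real) \<Rightarrow> bool" where
  "L2_converges M f f0 \<longleftrightarrow>
     (\<forall>\<^sub>F n in sequentially. f n \<in> L2 M) \<and> f0 \<in> L2 M \<and>
     (\<lambda>n. sqrt (\<integral>x. (f n x - f0 x)\<^sup>2 \<partial>M)) \<longlonglongrightarrow> 0"


section \<open>Sets with \<open>W\<^sup>2\<^sup>,\<^sup>\<infinity>\<close> boundary\<close>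

definition partial_deriv :: "'d \<Rightarrow> (real ^ 'd \<Rightarrow> real) \<Rightarrow> real ^ 'd \<Rightarrow> real" where
  "partial_deriv i f x = frechet_derivative f (at x) (axis i 1)"

definition iter_partial :: "'d list \<Rightarrow> (real ^ 'd \<Rightarrow> real) \<Rightarrow> real ^ 'd \<Rightarrow> real" where
  "iter_partial is f = foldr partial_deriv is f"

definition test_function :: "(real ^ 'd \<Rightarrow> real) \<Rightarrow> bool" where
  "test_function \<eta> \<longleftrightarrow>
     (\<forall>is x. iter_partial is \<eta> differentiable (at x)) \<and> compact (closure {x. \<eta> x \<noteq> 0})"

definition L_infty :: "(real ^ 'd \<Rightarrow> real) set" where
  "L_infty = {f \<in> borel_measurable lebesgue. \<exists>C. AE x in lebesgue. \<bar>f x\<bar> \<le> C}"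

definition weak_partial :: "'d list \<Rightarrow> (real ^ 'd \<Rightarrow> real) \<Rightarrow> (real ^ 'd \<Rightarrow> real) \<Rightarrow> bool" where
  "weak_partial is f g \<longleftrightarrow>
     (\<forall>\<eta>. test_function \<eta> \<longrightarrow>
        (\<integral>x. f x * iter_partial is \<eta> x \<partial>lebesgue) = (-1) ^ length is * (\<integral>x. g x * \<eta> x \<partial>lebesgue))"

definition W_infty :: "nat \<Rightarrow> (real ^ 'd \<Rightarrow> real) set" where
  "W_infty m = {f \<in> L_infty. \<forall>is. length is \<le> m \<longrightarrow> (\<exists>g\<in>L_infty. weak_partial is f g)}"

text \<open>
  Near each boundary point the set is the region below the graph, in some unit direction \<open>e\<close>,
  of a \<open>W\<^sup>2\<^sup>,\<^sup>\<infinity>\<close> function on the hyperplane orthogonal to \<open>e\<close>. Such a function on a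
  \<open>(d - 1)\<close>-dimensional space is encoded as a function on \<open>\<real>\<^sup>d\<close> that is constant along \<open>e\<close>;
  continuity selects the right representative of the \<open>W\<^sup>2\<^sup>,\<^sup>\<infinity>\<close> class.
\<close>

definition W2_infty_boundary :: "(real ^ 'd) set \<Rightarrow> bool" where
  "W2_infty_boundary U \<longleftrightarrow>
     (\<forall>p\<in>frontier U. \<exists>r>0. \<exists>e. \<exists>\<gamma>\<in>W_infty 2.
        norm e = 1 \<and> continuous_on UNIV \<gamma> \<and> (\<forall>x t. \<gamma> (x + t *\<^sub>R e) = \<gamma> x) \<and>
        U \<inter> ball p r = {x \<in> ball p r. x \<bullet> e < \<gamma> x})"

definition regular_domain :: "(real ^ 'd) set \<Rightarrow> bool" where
  "regular_domain S \<longleftrightarrow>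
     S \<subseteq> torus \<and> bounded S \<and> open (lift_set S) \<and> W2_infty_boundary (lift_set S)"


section \<open>The heat semigroup on the torus\<close>

definition heat_kernel :: "real \<Rightarrow> real ^ 'd \<Rightarrow> real" where
  "heat_kernel h z = (4 * pi * h) powr (- real CARD('d) / 2) * exp (- (norm z)\<^sup>2 / (4 * h))"

text \<open>
  \<open>heat_semigroup h v\<close> is \<open>e\<^bsup>-h\<Delta>\<^esup> v\<close>, where \<open>\<Delta> = - (\<partial>\<^sub>1\<^sup>2 + \<dots> + \<partial>\<^sub>d\<^sup>2)\<close>: the convolution of the
  periodic extension of \<open>v\<close> with the heat kernel of \<open>\<real>\<^sup>d\<close>.
\<close>

definition heat_semigroup :: "real \<Rightarrow> (real ^ 'd \<Rightarrow> real) \<Rightarrow> real ^ 'd \<Rightarrow> real" where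
  "heat_semigroup h v x = (\<integral>y. heat_kernel h (x - y) * v (wrap y) \<partial>lebesgue)"


subsection \<open>Action on the eigenfunctions of the Laplacian\<close>

text \<open>
  The Fourier modes of frequency \<open>k \<in> \<int>\<^sup>d\<close> are eigenfunctions of \<open>\<Delta>\<close> for the eigenvalue
  \<open>4 \<pi>\<^sup>2 |k|\<^sup>2\<close>, and the operator above multiplies them by \<open>e\<^bsup>-h 4 \<pi>\<^sup>2 |k|\<^sup>2\<^esup>\<close>.
\<close>

lemma norm_sq_eq_sum: "(norm x)\<^sup>2 = (\<Sum>b\<in>Basis. (x \<bullet> b)\<^sup>2)" for x :: "'a::euclidean_space"
  unfolding power2_norm_eq_inner by (subst euclidean_inner) (simp add: power2_eq_square)

lemma heat_kernel_eq_prod: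
  fixes z :: "real ^ 'd"
  assumes "h > 0"
  shows "heat_kernel h z = (\<Prod>b\<in>Basis. normal_density 0 (sqrt (2 * h)) (z \<bullet> b))"
proof -
  have "(\<Prod>b\<in>(Basis :: (real ^ 'd) set). normal_density 0 (sqrt (2 * h)) (z \<bullet> b))
      = (\<Prod>b\<in>(Basis :: (real ^ 'd) set). 1 / sqrt (4 * pi * h)) *
        (\<Prod>b\<in>(Basis :: (real ^ 'd) set). exp (- ((z \<bullet> b)\<^sup>2 / (4 * h))))"
    using assms by (simp add: normal_density_def prod_dividef mult_ac power_one_over)
  also have "(\<Prod>b\<in>(Basis :: (real ^ 'd) set). exp (- ((z \<bullet> b)\<^sup>2 / (4 * h))))
      = exp (- (norm z)\<^sup>2 / (4 * h))"
    unfolding norm_sq_eq_sum by (simp add: exp_sum [symmetric] sum_negf sum_divide_distrib)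
  also have "(\<Prod>b\<in>(Basis :: (real ^ 'd) set). 1 / sqrt (4 * pi * h))
      = (4 * pi * h) powr (- real CARD('d) / 2)"
  proof -
    have "1 / sqrt (4 * pi * h) = (4 * pi * h) powr (- 1 / 2)"
      using assms by (simp add: powr_minus_divide powr_half_sqrt)
    moreover have "((4 * pi * h) powr (- 1 / 2)) ^ CARD('d) = (4 * pi * h) powr (- real CARD('d) / 2)"
      using assms by (subst powr_power) auto
    ultimately show ?thesis
      by (simp only: prod_constant) simp
  qed
  finally show ?thesis
    by (simp add: heat_kernel_def)
qed

lemma normal_char:
  assumes "h > 0"
  shows "integrable lborel (\<lambda>y. normal_density 0 (sqrt (2 * h)) y *\<^sub>R cis (t * y))"
    and "(\<integral>y. normal_density 0 (sqrt (2 * h)) y *\<^sub>R cis (t * y) \<partial>lborel)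
           = complex_of_real (exp (- h * t\<^sup>2))"
proof -
  define s where "s = sqrt (2 * h)"
  have s: "s > 0" "s\<^sup>2 = 2 * h"
    using assms by (auto simp: s_def)
  have "integrable lborel (\<lambda>y. normal_density 0 s y)"
    using s integrable_normal_density by blast
  then show "integrable lborel (\<lambda>y. normal_density 0 (sqrt (2 * h)) y *\<^sub>R cis (t * y))"
    unfolding s_def [symmetric]
    by (rule Bochner_Integration.integrable_bound) (auto simp: cis_conv_exp normal_density_nonneg)
  have d: "s * normal_density 0 s (s * y) = std_normal_density y" for y
  proof -
    have "sqrt (2 * pi * s\<^sup>2) = s * sqrt (2 * pi)"
      using s(1) by (simp add: real_sqrt_mult)
    then show ?thesis
      using s(1) by (simp add: normal_density_def power_mult_distrib)
  qed
  have "(\<integral>y. normal_density 0 s y *\<^sub>R cis (t * y) \<partial>lborel)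
      = s *\<^sub>R (\<integral>y. normal_density 0 s (s * y) *\<^sub>R cis (t * (s * y)) \<partial>lborel)"
    using s lborel_integral_real_affine [of s "\<lambda>y. normal_density 0 s y *\<^sub>R cis (t * y)" 0] by simp
  also have "\<dots> = (\<integral>y. s *\<^sub>R (normal_density 0 s (s * y) *\<^sub>R cis (t * (s * y))) \<partial>lborel)"
    by (rule integral_scaleR_right [symmetric]) 
  also have "\<dots> = (\<integral>y. std_normal_density y *\<^sub>R cis (t * s * y) \<partial>lborel)"
    by (simp only: scaleR_scaleR d mult.assoc)
  also have "\<dots> = char std_normal_distribution (t * s)"
    unfolding char_def
    by (subst integral_density) (auto simp: cis_conv_exp normal_density_nonneg mult_ac)
  also have "\<dots> = complex_of_real (exp (- h * t\<^sup>2))"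
    using s by (simp add: char_std_normal_distribution power_mult_distrib mult_ac)
  finally show "(\<integral>y. normal_density 0 (sqrt (2 * h)) y *\<^sub>R cis (t * y) \<partial>lborel)
      = complex_of_real (exp (- h * t\<^sup>2))"
    by (simp add: s_def)
qed

lemma heat_kernel_char:
  fixes t :: "real ^ 'd"
  assumes "h > 0"
  shows "(\<integral>z. heat_kernel h z *\<^sub>R cis (t \<bullet> z) \<partial>lborel) = complex_of_real (exp (- h * (norm t)\<^sup>2))"
    and "integrable lborel (\<lambda>z. heat_kernel h z *\<^sub>R cis (t \<bullet> z))"
proof -
  interpret product_sigma_finite "\<lambda>_ :: real ^ 'd. lborel :: real measure" ..
  let ?B = "Basis :: (real ^ 'd) set"
  let ?g = "\<lambda>b y. normal_density 0 (sqrt (2 * h)) y *\<^sub>R cis ((t \<bullet> b) * y)"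
  let ?s = "\<lambda>f. \<Sum>b\<in>?B. f b *\<^sub>R b"
  have coord: "?s f \<bullet> b = f b" if "b \<in> ?B" for f b
    using that by simp
  have cis_prod: "cis (\<Sum>b\<in>A. a b) = (\<Prod>b\<in>A. cis (a b))" if "finite A" for A :: "(real ^ 'd) set" and a
    using that by induction (simp_all add: cis_mult [symmetric])
  have eq: "heat_kernel h (?s f) *\<^sub>R cis (t \<bullet> ?s f) = (\<Prod>b\<in>?B. ?g b (f b))" for f
  proof -
    have "t \<bullet> ?s f = (\<Sum>b\<in>?B. (t \<bullet> b) * f b)"
      by (simp add: inner_sum_right mult_ac)
    moreover have "heat_kernel h (?s f) = (\<Prod>b\<in>?B. normal_density 0 (sqrt (2 * h)) (f b))"
      unfolding heat_kernel_eq_prod [OF assms] by (intro prod.cong refl) (simp only: coord)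
    ultimately show ?thesis
      by (simp add: cis_prod scaleR_conv_of_real prod.distrib)
  qed
  have meas: "(\<lambda>z. heat_kernel h z *\<^sub>R cis (t \<bullet> z)) \<in> borel_measurable borel"
    unfolding heat_kernel_def cis_conv_exp by measurable
  have meas_s: "?s \<in> measurable (\<Pi>\<^sub>M b\<in>?B. lborel) borel"
    by measurable
  have "(\<integral>z. heat_kernel h z *\<^sub>R cis (t \<bullet> z) \<partial>lborel)
      = (\<integral>f. (\<Prod>b\<in>?B. ?g b (f b)) \<partial>(\<Pi>\<^sub>M b\<in>?B. lborel))"
    by (subst lborel_eq, subst integral_distr [OF meas_s meas]) (simp only: eq)
  also have "\<dots> = (\<Prod>b\<in>?B. integral\<^sup>L lborel (?g b))"
    using normal_char(1) [OF assms] by (intro product_integral_prod) auto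
  also have "\<dots> = (\<Prod>b\<in>?B. complex_of_real (exp (- h * (t \<bullet> b)\<^sup>2)))"
    by (simp only: normal_char(2) [OF assms])
  also have "\<dots> = complex_of_real (exp (- h * (norm t)\<^sup>2))"
    unfolding norm_sq_eq_sum of_real_prod [symmetric] exp_sum [OF finite_Basis, symmetric]
      sum_distrib_left ..
  finally show "(\<integral>z. heat_kernel h z *\<^sub>R cis (t \<bullet> z) \<partial>lborel) = complex_of_real (exp (- h * (norm t)\<^sup>2))" .
  have "integrable (\<Pi>\<^sub>M b\<in>?B. lborel) (\<lambda>f. \<Prod>b\<in>?B. ?g b (f b))"
    using normal_char(1) [OF assms] by (intro product_integrable_prod) auto
  then show "integrable lborel (\<lambda>z. heat_kernel h z *\<^sub>R cis (t \<bullet> z))"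
    by (subst lborel_eq, subst integrable_distr_eq [OF meas_s meas]) (simp only: eq)
qed

lemma cis_inner_wrap:
  assumes "k \<in> int_lattice"
  shows "cis (2 * pi * (k \<bullet> wrap y)) = cis (2 * pi * (k \<bullet> y))"
proof -
  have "k \<bullet> y - k \<bullet> wrap y = (\<Sum>i\<in>UNIV. k $ i * of_int \<lfloor>y $ i\<rfloor>)"
    by (simp add: inner_vec_def wrap_def frac_def sum_subtractf [symmetric] algebra_simps)
  also have "\<dots> \<in> \<int>"
    using assms by (auto simp: int_lattice_def)
  finally obtain n where "k \<bullet> y = k \<bullet> wrap y + of_int n"
    by (metis Ints_cases add.commute diff_add_cancel)
  then have "cis (2 * pi * (k \<bullet> y)) = cis (2 * pi * (k \<bullet> wrap y)) * cis (2 * pi * of_int n)"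
    by (simp add: cis_mult algebra_simps)
  then show ?thesis
    by simp
qed

lemma heat_semigroup_fourier_mode:
  fixes k x :: "real ^ 'd"
  assumes "h > 0" and "k \<in> int_lattice"
  shows "heat_semigroup h (\<lambda>y. cos (2 * pi * (k \<bullet> y))) x
           = exp (- h * (4 * pi\<^sup>2 * (norm k)\<^sup>2)) * cos (2 * pi * (k \<bullet> x))"
    and "heat_semigroup h (\<lambda>y. sin (2 * pi * (k \<bullet> y))) x
           = exp (- h * (4 * pi\<^sup>2 * (norm k)\<^sup>2)) * sin (2 * pi * (k \<bullet> x))"
proof -
  define F where "F y = heat_kernel h (x - y) *\<^sub>R cis (2 * pi * (k \<bullet> y))" for y
  have meas: "F \<in> borel_measurable borel"
    unfolding F_def heat_kernel_def cis_conv_exp by measurable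
  have refl: "lborel = distr lborel borel (\<lambda>z :: real ^ 'd. x - z)"
    using lborel_affine [of "- 1" x] by (simp add: density_1)
  have F_refl: "F (x - z) = cis (2 * pi * (k \<bullet> x)) * (heat_kernel h z *\<^sub>R cis ((- (2 * pi) *\<^sub>R k) \<bullet> z))"
    for z
    by (simp add: F_def cis_mult inner_diff_right algebra_simps)
  have "integrable lborel (\<lambda>z. F (x - z))"
    unfolding F_refl by (intro integrable_mult_right heat_kernel_char(2) assms)
  then have int: "integrable lborel F"
    by (subst refl, subst integrable_distr_eq) (auto simp: meas)
  have "integral\<^sup>L lborel F = (\<integral>z. F (x - z) \<partial>lborel)"
    by (subst refl, subst integral_distr) (auto simp: meas)
  also have "\<dots> = cis (2 * pi * (k \<bullet> x)) * exp (- h * (4 * pi\<^sup>2 * (norm k)\<^sup>2))"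
    unfolding F_refl integral_mult_right_zero heat_kernel_char(1) [OF assms(1)]
    by (simp add: power_mult_distrib)
  finally have F: "integral\<^sup>L lebesgue F = cis (2 * pi * (k \<bullet> x)) * exp (- h * (4 * pi\<^sup>2 * (norm k)\<^sup>2))"
    using meas by (simp add: integral_completion)
  have intF: "integrable lebesgue F"
    using int meas by (simp add: integrable_completion)
  have eq: "F y = heat_kernel h (x - y) *\<^sub>R cis (2 * pi * (k \<bullet> wrap y))" for y
    by (simp add: F_def cis_inner_wrap [OF assms(2)])
  have "heat_semigroup h (\<lambda>y. cos (2 * pi * (k \<bullet> y))) x = Re (integral\<^sup>L lebesgue F)"
    by (subst integral_Re [OF intF, symmetric]) (simp add: heat_semigroup_def eq)
  then show "heat_semigroup h (\<lambda>y. cos (2 * pi * (k \<bullet> y))) x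
           = exp (- h * (4 * pi\<^sup>2 * (norm k)\<^sup>2)) * cos (2 * pi * (k \<bullet> x))"
    by (simp add: F exp_of_real)
  have "heat_semigroup h (\<lambda>y. sin (2 * pi * (k \<bullet> y))) x = Im (integral\<^sup>L lebesgue F)"
    by (subst integral_Im [OF intF, symmetric]) (simp add: heat_semigroup_def eq)
  then show "heat_semigroup h (\<lambda>y. sin (2 * pi * (k \<bullet> y))) x
           = exp (- h * (4 * pi\<^sup>2 * (norm k)\<^sup>2)) * sin (2 * pi * (k \<bullet> x))"
    by (simp add: F exp_of_real)
qed


section \<open>Discrete operators and the obstacle MBO schemes\<close>

text \<open>
  A linear operator on functions \<open>X \<rightarrow> \<real>\<close>, with \<open>X\<close> finite, is given by its matrix \<open>A\<close>. Only values
  at points of \<open>X\<close> are meaningful, for functions and for matrices alike.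
\<close>

definition matrix_op :: "'a set \<Rightarrow> ('a \<Rightarrow> 'a \<Rightarrow> real) \<Rightarrow> ('a \<Rightarrow> real) \<Rightarrow> 'a \<Rightarrow> real" where
  "matrix_op X A v x = (\<Sum>y\<in>X. A x y * v y)"

definition discrete_semigroup ::
    "real \<Rightarrow> 'a set \<Rightarrow> ('a \<Rightarrow> 'a \<Rightarrow> real) \<Rightarrow> ('a \<Rightarrow> real) \<Rightarrow> 'a \<Rightarrow> real" where
  "discrete_semigroup h X A v x = (\<Sum>n. (- h) ^ n / fact n * (matrix_op X A ^^ n) v x)"

definition mbo_sign :: "real \<Rightarrow> real" where
  "mbo_sign s = (if s > 0 then 1 else - 1)"

primrec discrete_mbo :: "real \<Rightarrow> 'a set \<Rightarrow> ('a \<Rightarrow> 'a \<Rightarrow> real) \<Rightarrow> ('a \<Rightarrow> real) \<Rightarrow> ('a \<Rightarrow> real) \<Rightarrow>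
    ('a \<Rightarrow> real) \<Rightarrow> nat \<Rightarrow> 'a \<Rightarrow> real" where
  "discrete_mbo h X A \<phi> \<psi> u0 0 = u0"
| "discrete_mbo h X A \<phi> \<psi> u0 (Suc l) = (\<lambda>x.
     mbo_sign (discrete_semigroup h X A (discrete_mbo h X A \<phi> \<psi> u0 l) x
       + indicat_real {y \<in> X. \<phi> y = 1} x - indicat_real {y \<in> X. \<psi> y = - 1} x))"

primrec continuous_mbo :: "real \<Rightarrow> (real ^ 'd) set \<Rightarrow> (real ^ 'd) set \<Rightarrow> (real ^ 'd \<Rightarrow> real) \<Rightarrow>
    nat \<Rightarrow> real ^ 'd \<Rightarrow> real" where
  "continuous_mbo h \<Phi> \<Psi> u0 0 = u0"
| "continuous_mbo h \<Phi> \<Psi> u0 (Suc l) = (\<lambda>x.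
     mbo_sign (heat_semigroup h (continuous_mbo h \<Phi> \<Psi> u0 l) x
       + indicat_real \<Phi> x - indicat_real \<Psi> x))"

definition inner_obstacle_fun :: "'a set \<Rightarrow> 'a \<Rightarrow> real" where
  "inner_obstacle_fun \<Phi> x = (if x \<in> \<Phi> then 1 else - 1)"

definition outer_obstacle_fun :: "'a set \<Rightarrow> 'a \<Rightarrow> real" where
  "outer_obstacle_fun \<Psi> x = (if x \<in> \<Psi> then - 1 else 1)"


section \<open>Space discretizations of the torus\<close>

text \<open>
  \<open>X N\<close> has \<open>N\<close> points, so everything is required for \<open>N \<ge> 1\<close> only. The map \<open>T N\<close> takes values
  in \<open>X N\<close>, and \<open>uniform_count_measure (X N)\<close> is the empirical measure regarded as a measure
  on \<open>X N\<close>. The map \<open>A N\<close> is the matrix of the discrete Laplacian.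
\<close>

definition space_discretization :: "real \<Rightarrow> (nat \<Rightarrow> (real ^ 'd) set) \<Rightarrow>
    (nat \<Rightarrow> real ^ 'd \<Rightarrow> real ^ 'd) \<Rightarrow> (real ^ 'd) measure \<Rightarrow>
    (nat \<Rightarrow> real ^ 'd \<Rightarrow> real ^ 'd \<Rightarrow> real) \<Rightarrow> bool" where
  "space_discretization h X T \<mu> A \<longleftrightarrow>
     (\<forall>N\<ge>1. X N \<subseteq> torus \<and> finite (X N) \<and> card (X N) = N) \<and>
     (\<forall>N\<ge>1. T N \<in> measurable torus_measure (count_space (X N))) \<and>
     (\<lambda>N. esssup torus_measure (\<lambda>x. ereal (torus_dist (T N x) x))) \<longlonglongrightarrow> 0 \<and>
     (\<exists>\<rho>\<in>borel_measurable torus_measure. (AE x in torus_measure. \<rho> x > (0::real)) \<and>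
        \<mu> = density torus_measure (\<lambda>x. ennreal (\<rho> x))) \<and>
     (\<forall>N\<ge>1. distr \<mu> (count_space (X N)) (T N) = uniform_count_measure (X N)) \<and>
     (\<forall>N\<ge>1. \<forall>x\<in>X N. \<forall>y\<in>X N. A N x y = A N y x) \<and>
     (\<forall>vN v. L2_weakly_converges torus_measure (\<lambda>N. vN N \<circ> T N) v \<longrightarrow>
        L2_converges torus_measure
          (\<lambda>N. discrete_semigroup h (X N) (A N) (vN N) \<circ> T N) (heat_semigroup h v))"

end

(*
  Weakly convergent functions with values -1 and 1 converge strongly in L^2. Hence the argument of
  the sign in the discrete scheme, which is e^{-h Delta_N} u_N + (phi_N + psi_N) / 2, converges
  strongly, and so does its sign provided that the limit vanishes only on a null set; by induction
  the whole sequence converges, without passing to a subsequence.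

  On the inner obstacle the iterate is 1, so e^{-h Delta} u > -1 everywhere and the limit is positive
  there; the outer obstacle is symmetric. Elsewhere the limit is V = e^{-h Delta} u, the convolution
  of a periodic function w with a Gaussian, whose restriction to every line is, up to a nonvanishing
  factor, an entire function. Fubini over the lines through a point where V does not vanish shows
  that the zeros of V are null. If V vanished identically, its values at complex points would vanish
  too, so the Fourier transform of a Gaussian times w would be 0, and then every average of w against
  a narrower Gaussian would be 0. This is impossible because every iterate is constant, equal to 1 or
  -1, on some nonempty open set.
*)

theory Submission
  imports Defs "HOL-Complex_Analysis.Cauchy_Integral_Formula"
begin

section \<open>Isolated zeros of real power series, and moment integrals that are entire in a
  parameter\<close>

section \<open>Real entire functions\<close>

text \<open>A nonzero coefficient would, by \<open>powser_0_nonzero\<close>, keep the sum away from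
  0 on a punctured neighbourhood of 0. The constant coefficient is treated first, by evaluating at
  0.\<close>

lemma real_powser_all_zero:
  fixes c :: "nat \<Rightarrow> real"
  assumes "\<And>t. (\<lambda>n. c n * t ^ n) sums 0"
  shows "c n = 0"
proof (rule ccontr)
  assume n: "c n \<noteq> 0"
  have "c 0 = 0"
    using sums_unique2 [OF assms [of 0] powser_sums_zero [of c]] by simp
  with n have "n > 0"
    by (cases n) auto
  show False
  proof (rule powser_0_nonzero [where 'a = real, of 1 0 c "\<lambda>_. 0", OF _ _ _ n \<open>n > 0\<close>])
    fix s :: real
    assume "0 < s" and "\<And>z::real. z \<in> cball 0 s - {0} \<Longrightarrow> (0::real) \<noteq> 0"
    from this(2) [of s] this(1) show False
      by auto
  qed (use assms in auto)
qed

text \<open>Zeros cannot accumulate: at an accumulation point the function vanishes by continuity,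
  so its nontrivial expansion there has an isolated zero. A subset of the line without accumulation
  points is countable.\<close>

lemma real_entire_countable_zeros:
  fixes f :: "real \<Rightarrow> real"
  assumes entire: "\<And>t0. \<exists>c. \<forall>t. (\<lambda>n. c n * (t - t0) ^ n) sums f t"
    and "f t1 \<noteq> 0"
  shows "countable {t. f t = 0}"
proof -
  have "{t. f t = 0} sparse_in UNIV"
    unfolding sparse_in_open [OF open_UNIV]
  proof (intro ballI notI)
    fix x :: real assume "x islimpt {t. f t = 0}"
    obtain c where c: "\<And>t. (\<lambda>n. c n * (t - x) ^ n) sums f t"
      using entire [of x] by auto
    have "f x = 0"
    proof (rule ccontr)
      assume "f x \<noteq> 0"
      \<comment> \<open>Convergence at distance 1 from \<open>x\<close> already makes the power
        series continuous at 0.\<close>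
      have "isCont (\<lambda>u. \<Sum>n. c n * u ^ n) 0"
        using c [of "x + 1"] by (intro isCont_powser [of c 1]) (auto simp: sums_iff)
      then have "isCont (\<lambda>u. f (x + u)) 0"
        using c [of "x + _"] by (simp add: sums_iff)
      then have "isCont f x"
        by (simp add: isCont_iff LIM_offset_zero_iff isCont_def)
      then have "\<forall>\<^sub>F t in at x. f t \<noteq> 0"
        using \<open>f x \<noteq> 0\<close> by (simp add: isCont_def tendsto_imp_eventually_ne)
      with \<open>x islimpt _\<close> show False
        by (simp add: islimpt_iff_eventually)
    qed
    \<comment> \<open>The expansion about \<open>x\<close> converges on the whole line, in
      particular at \<open>t1\<close>, so its coefficients cannot all vanish. No connectedness
      argument is required.\<close>
    obtain m where m: "c m \<noteq> 0"
    proof (rule ccontr)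
      assume "\<not> thesis"
      then have "c = (\<lambda>_. 0)"
        using that by auto
      with c [of t1] \<open>f t1 \<noteq> 0\<close> show False
        by (auto simp: sums_iff)
    qed
    have "c 0 = 0"
      using c [of x] \<open>f x = 0\<close> by simp
    with m have "m > 0"
      by (cases m) auto
    obtain s where "0 < s" and s: "\<And>z. z \<in> cball x s - {x} \<Longrightarrow> f z \<noteq> 0"
      by (rule powser_0_nonzero [of 1 x c f, OF _ c \<open>f x = 0\<close> m \<open>m > 0\<close>]) auto
    from \<open>x islimpt _\<close> obtain y where "f y = 0" "y \<in> ball x s" "y \<noteq> x"
      using \<open>0 < s\<close> by (auto elim!: islimptE [of x _ "ball x s"])
    with s [of y] show False
      by auto
  qed
  then show ?thesis
    using sparse_imp_countable [of UNIV "{t. f t = 0}"] by simp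
qed

text \<open>Termwise integration: the bound on \<open>b\<close> dominates all partial sums by
  \<open>\<bar>g\<bar> * exp \<bar>a\<bar>\<close>, hence by the integrable \<open>G\<close>,
  because \<open>exp \<bar>a\<bar>\<close> is one of \<open>exp a\<close> and
  \<open>exp (- a)\<close>. Leaving \<open>b\<close> general covers both the exponential and the
  cosine series.\<close>

lemma exp_moment_sums:
  fixes g a :: "'a \<Rightarrow> real"
  assumes [measurable]: "g \<in> borel_measurable M" "a \<in> borel_measurable M"
    and int: "integrable M (\<lambda>y. g y * exp (a y))" "integrable M (\<lambda>y. g y * exp (- a y))"
    and b: "\<And>n. \<bar>b n\<bar> \<le> 1 / fact n"
  shows "(\<lambda>n. b n * (\<integral>y. g y * a y ^ n \<partial>M)) sums (\<integral>y. g y * (\<Sum>n. b n * a y ^ n) \<partial>M)"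
proof -
  define G where "G y = \<bar>g y * exp (a y)\<bar> + \<bar>g y * exp (- a y)\<bar>" for y
  have G: "integrable M G"
    unfolding G_def using int by (intro Bochner_Integration.integrable_add integrable_abs)
  have exp_le: "\<bar>g y\<bar> * exp \<bar>a y\<bar> \<le> G y" for y
    by (cases "a y \<ge> 0") (auto simp: G_def abs_mult)
  have exp_sums: "(\<lambda>n. \<bar>g y\<bar> * (\<bar>a y\<bar> ^ n / fact n)) sums (\<bar>g y\<bar> * exp \<bar>a y\<bar>)" for y
    using sums_mult [OF exp_converges [of "\<bar>a y\<bar>"], of "\<bar>g y\<bar>"] by (simp add: divide_inverse mult_ac)
  have term_le: "\<bar>g y * (b n * a y ^ n)\<bar> \<le> \<bar>g y\<bar> * (\<bar>a y\<bar> ^ n / fact n)" for y n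
    using mult_left_mono [OF mult_right_mono [OF b [of n], of "\<bar>a y\<bar> ^ n"], of "\<bar>g y\<bar>"]
    by (simp add: abs_mult power_abs)
  have partial: "(\<Sum>n\<in>A. \<bar>g y * (b n * a y ^ n)\<bar>) \<le> G y" if "finite A" for y A
  proof -
    have "(\<Sum>n\<in>A. \<bar>g y * (b n * a y ^ n)\<bar>) \<le> (\<Sum>n\<in>A. \<bar>g y\<bar> * (\<bar>a y\<bar> ^ n / fact n))"
      by (intro sum_mono term_le)
    also have "\<dots> \<le> (\<Sum>n. \<bar>g y\<bar> * (\<bar>a y\<bar> ^ n / fact n))"
      by (rule sum_le_suminf [OF sums_summable [OF exp_sums] that]) auto
    also have "\<dots> = \<bar>g y\<bar> * exp \<bar>a y\<bar>"
      by (rule sums_unique [OF exp_sums, symmetric])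
    finally show ?thesis
      using exp_le [of y] by linarith
  qed
  have term_int: "integrable M (\<lambda>y. g y * (b n * a y ^ n))" for n
    using partial [of "{n}"]
    by (intro Bochner_Integration.integrable_bound [OF G]) (auto intro: order_trans [OF _ abs_ge_self])
  have sm: "summable (\<lambda>n. \<bar>g y * (b n * a y ^ n)\<bar>)" for y
    by (rule summable_comparison_test' [OF sums_summable [OF exp_sums [of y]], of 0])
      (use term_le in auto)
  have "(\<lambda>n. \<integral>y. g y * (b n * a y ^ n) \<partial>M) sums (\<integral>y. (\<Sum>n. g y * (b n * a y ^ n)) \<partial>M)"
  proof (rule sums_integral [OF term_int])
    show "AE y in M. summable (\<lambda>n. norm (g y * (b n * a y ^ n)))"
      using sm by simp
    show "summable (\<lambda>n. \<integral>y. norm (g y * (b n * a y ^ n)) \<partial>M)"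
    proof (rule summableI_nonneg_bounded)
      fix n
      have "(\<Sum>i<n. \<integral>y. norm (g y * (b i * a y ^ i)) \<partial>M) = (\<integral>y. (\<Sum>i<n. \<bar>g y * (b i * a y ^ i)\<bar>) \<partial>M)"
        using term_int by (subst Bochner_Integration.integral_sum) auto
      also have "\<dots> \<le> (\<integral>y. G y \<partial>M)"
        by (intro integral_mono Bochner_Integration.integrable_sum integrable_abs term_int G partial) auto
      finally show "(\<Sum>i<n. \<integral>y. norm (g y * (b i * a y ^ i)) \<partial>M) \<le> (\<integral>y. G y \<partial>M)" .
    qed auto
  qed
  \<comment> \<open>Where \<open>g y\<close> is nonzero it can be cancelled to get summability of
    the inner series; elsewhere both sides are 0.\<close>
  moreover have "(\<Sum>n. g y * (b n * a y ^ n)) = g y * (\<Sum>n. b n * a y ^ n)" for y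
  proof (cases "g y = 0")
    case False
    then have "summable (\<lambda>n. b n * a y ^ n)"
      using summable_rabs_cancel [OF sm [of y]] by (simp add: summable_cmult_iff)
    then show ?thesis
      by (rule suminf_mult [symmetric, symmetric])
  qed simp
  ultimately show ?thesis
    by (simp add: mult.left_commute)
qed

lemma exp_moment_entire:
  fixes g a :: "'a \<Rightarrow> real"
  assumes [measurable]: "g \<in> borel_measurable M" "a \<in> borel_measurable M"
    and int: "\<And>t. integrable M (\<lambda>y. g y * exp (t * a y))"
  shows "(\<lambda>n. ((\<integral>y. g y * a y ^ n \<partial>M) / fact n) * t ^ n) sums (\<integral>y. g y * exp (t * a y) \<partial>M)"
proof -
  have "(\<lambda>n. (1 / fact n) * (\<integral>y. g y * (t * a y) ^ n \<partial>M)) sums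
      (\<integral>y. g y * (\<Sum>n. (1 / fact n) * (t * a y) ^ n) \<partial>M)"
    using int [of t] int [of "- t"] by (intro exp_moment_sums) auto
  moreover have "(\<Sum>n. (1 / fact n) * x ^ n) = exp x" for x :: real
    by (simp add: exp_def divide_inverse)
  moreover have "(\<integral>y. g y * (t * a y) ^ n \<partial>M) = t ^ n * (\<integral>y. g y * a y ^ n \<partial>M)" for n
    by (simp add: power_mult_distrib mult.left_commute flip: integral_mult_right_zero)
  ultimately show ?thesis
    by (simp add: mult_ac)
qed

text \<open>To expand about an arbitrary \<open>t0\<close>, the factor \<open>exp (t0 * a y)\<close>
  is absorbed into the weight \<open>g\<close>; this reduces everything to the expansion about
  0.\<close>

lemma exp_moment_countable_zeros:
  fixes g a :: "'a \<Rightarrow> real"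
  assumes [measurable]: "g \<in> borel_measurable M" "a \<in> borel_measurable M"
    and int: "\<And>t. integrable M (\<lambda>y. g y * exp (t * a y))"
    and "(\<integral>y. g y * exp (t1 * a y) \<partial>M) \<noteq> 0"
  shows "countable {t. (\<integral>y. g y * exp (t * a y) \<partial>M) = 0}"
proof (rule real_entire_countable_zeros [where ?t1.0 = t1], intro exI allI)
  fix t0 t
  have shift: "g y * exp (t0 * a y) * exp (u * a y) = g y * exp ((t0 + u) * a y)" for u y
    by (simp add: exp_add algebra_simps)
  show "(\<lambda>n. (\<integral>y. g y * exp (t0 * a y) * a y ^ n \<partial>M) / fact n * (t - t0) ^ n)
      sums (\<integral>y. g y * exp (t * a y) \<partial>M)"
    using exp_moment_entire [of "\<lambda>y. g y * exp (t0 * a y)" M a "t - t0"] int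
    by (simp add: shift)
qed (rule assms(4))

text \<open>Both integrals are power series in the moments of \<open>a\<close> against \<open>g\<close>.\<close>

lemma laplace_zero_imp_cos_zero:
  fixes g a :: "'a \<Rightarrow> real"
  assumes [measurable]: "g \<in> borel_measurable M" "a \<in> borel_measurable M"
    and int: "\<And>t. integrable M (\<lambda>y. g y * exp (t * a y))"
    and zero: "\<And>t. (\<integral>y. g y * exp (t * a y) \<partial>M) = 0"
  shows "(\<integral>y. g y * cos (a y) \<partial>M) = 0"
proof -
  have "(\<integral>y. g y * a y ^ n \<partial>M) / fact n = 0" for n
    by (rule real_powser_all_zero [of "\<lambda>n. (\<integral>y. g y * a y ^ n \<partial>M) / fact n"])
      (use exp_moment_entire [OF assms(1-2) int] zero in simp)
  then have moment: "(\<integral>y. g y * a y ^ n \<partial>M) = 0" for n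
    by simp
  have "(\<lambda>n. cos_coeff n * (\<integral>y. g y * a y ^ n \<partial>M)) sums (\<integral>y. g y * (\<Sum>n. cos_coeff n * a y ^ n) \<partial>M)"
    using int [of 1] int [of "- 1"] by (intro exp_moment_sums) (auto simp: cos_coeff_def)
  then show ?thesis
    by (simp add: moment sums_iff cos_def)
qed


section \<open>Gaussian convolution of a bounded function: strict bounds, continuity, analyticity on
  lines, null zero set\<close>

section \<open>Convolution with the heat kernel\<close>

lemma heat_kernel_pos: "h > 0 \<Longrightarrow> heat_kernel h z > 0"
  by (simp add: heat_kernel_def)

lemma heat_kernel_nonneg: "heat_kernel h z \<ge> 0"
  by (simp add: heat_kernel_def)

lemma heat_kernel_measurable [measurable]: "heat_kernel h \<in> borel_measurable borel"
  unfolding heat_kernel_def by measurable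

lemma lborel_reflect: "(lborel :: 'a::euclidean_space measure) = distr lborel borel (\<lambda>z. x - z)"
  using lborel_affine [of "- 1" x] by (simp add: density_1)

text \<open>Real parts of the characteristic function of the Gaussian; the total mass is its value
  at frequency 0.\<close>

lemma
  fixes t :: "real ^ 'd"
  assumes "h > 0"
  shows integrable_heat_kernel: "integrable lborel (heat_kernel h :: real ^ 'd \<Rightarrow> real)"
    and integral_heat_kernel: "(\<integral>z. heat_kernel h z \<partial>(lborel :: (real ^ 'd) measure)) = 1"
    and integral_heat_kernel_cos: "(\<integral>z. heat_kernel h z * cos (t \<bullet> z) \<partial>lborel) = exp (- h * (norm t)\<^sup>2)"
proof -
  show cos: "(\<integral>z. heat_kernel h z * cos (t \<bullet> z) \<partial>lborel) = exp (- h * (norm t)\<^sup>2)" for t :: "real ^ 'd"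
    using integral_Re [OF heat_kernel_char(2) [OF assms, of t]] heat_kernel_char(1) [OF assms, of t]
    by simp
  show "integrable lborel (heat_kernel h :: real ^ 'd \<Rightarrow> real)"
    using integrable_Re [OF heat_kernel_char(2) [OF assms, of 0]] by simp
  show "(\<integral>z. heat_kernel h z \<partial>(lborel :: (real ^ 'd) measure)) = 1"
    using cos [of 0] by simp
qed

lemma
  fixes x :: "real ^ 'd"
  assumes "h > 0"
  shows integrable_heat_kernel_reflect: "integrable lborel (\<lambda>y. heat_kernel h (x - y))"
    and integral_heat_kernel_reflect: "(\<integral>y. heat_kernel h (x - y) \<partial>lborel) = 1"
proof -
  have "integrable (distr lborel borel (\<lambda>z. x - z)) (heat_kernel h)"
    using integrable_heat_kernel [OF assms] by (simp flip: lborel_reflect)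
  then show "integrable lborel (\<lambda>y. heat_kernel h (x - y))"
    by (subst (asm) integrable_distr_eq) auto
  have "(\<integral>y. heat_kernel h y \<partial>distr lborel borel (\<lambda>z. x - z)) = 1"
    using integral_heat_kernel [OF assms] by (simp flip: lborel_reflect)
  then show "(\<integral>y. heat_kernel h (x - y) \<partial>lborel) = 1"
    by (subst (asm) integral_distr) auto
qed

text \<open>A zero integral would force \<open>f = 0\<close> almost everywhere and make
  \<open>U\<close> null, but \<open>U\<close> contains a ball of positive measure.\<close>

lemma integral_pos_open:
  fixes f :: "'a::euclidean_space \<Rightarrow> real"
  assumes f: "integrable lborel f" "\<And>x. f x \<ge> 0"
    and U: "open U" "U \<noteq> {}" "\<And>x. x \<in> U \<Longrightarrow> f x > 0"
  shows "(\<integral>x. f x \<partial>lborel) > 0"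
proof (rule ccontr)
  assume "\<not> ?thesis"
  moreover have "(\<integral>x. f x \<partial>lborel) \<ge> 0"
    using f(2) by (intro integral_nonneg_AE) auto
  ultimately have "(\<integral>x. f x \<partial>lborel) = 0"
    by simp
  then have "AE x in lborel. f x = 0"
    using f by (subst (asm) integral_nonneg_eq_0_iff_AE) auto
  then have "AE x in lborel. x \<notin> U"
    by (rule eventually_mono) (use U(3) in force)
  then have "emeasure lborel U = 0"
    using U(1) by (subst (asm) AE_iff_measurable [of U]) auto
  moreover obtain z r where "r > 0" "ball z r \<subseteq> U"
    using U by (meson all_not_in_conv open_contains_ball)
  then have "emeasure lborel (ball z r) \<le> emeasure lborel U"
    using U(1) by (intro emeasure_mono) auto
  moreover have "emeasure lborel (ball z r) \<noteq> 0"
    using \<open>r > 0\<close> open_not_negligible [of "ball z r"]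
    by (simp add: negligible_iff_emeasure0)
  ultimately show False
    by simp
qed

text \<open>Stated over \<open>lborel\<close> for a function on the whole space, so that
  product-measure results apply; the torus semigroup is recovered with
  \<open>w = v \<circ> wrap\<close>.\<close>

definition heat_conv :: "real \<Rightarrow> (real ^ 'd \<Rightarrow> real) \<Rightarrow> real ^ 'd \<Rightarrow> real" where
  "heat_conv h w x = (\<integral>y. heat_kernel h (x - y) * w y \<partial>lborel)"

lemma heat_semigroup_eq_heat_conv:
  assumes [measurable]: "(v \<circ> wrap) \<in> borel_measurable borel"
  shows "heat_semigroup h v = heat_conv h (v \<circ> wrap)"
proof
  fix x
  have "(\<lambda>y. heat_kernel h (x - y) * (v \<circ> wrap) y) \<in> borel_measurable lborel"
    by measurable
  then show "heat_semigroup h v x = heat_conv h (v \<circ> wrap) x"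
    unfolding heat_semigroup_def heat_conv_def by (subst integral_completion [symmetric]) (auto simp: o_def)
qed

lemma heat_conv_measurable [measurable]:
  assumes [measurable]: "w \<in> borel_measurable borel"
  shows "heat_conv h w \<in> borel_measurable borel"
  unfolding heat_conv_def by measurable

context
  fixes h :: real and w :: "real ^ 'd \<Rightarrow> real"
  assumes h: "h > 0" and w_meas [measurable]: "w \<in> borel_measurable borel" and w: "\<And>y. \<bar>w y\<bar> \<le> 1"
begin

lemma integrable_heat_conv: "integrable lborel (\<lambda>y. heat_kernel h (x - y) * w y)"
  by (rule Bochner_Integration.integrable_bound [OF integrable_heat_kernel_reflect [OF h, of x]])
    (auto simp: abs_mult heat_kernel_nonneg intro!: mult_left_le w)

text \<open>The kernel has mass 1, so \<open>1 + heat_conv h w x\<close> is the integral of the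
  kernel times \<open>1 + w\<close>, which is nonnegative and strictly positive on
  \<open>U\<close>.\<close>

lemma heat_conv_gt:
  assumes "open U" "U \<noteq> {}" "\<And>y. y \<in> U \<Longrightarrow> w y > - 1"
  shows "heat_conv h w x > - 1"
proof -
  have "0 < (\<integral>y. heat_kernel h (x - y) * (1 + w y) \<partial>lborel)"
  proof (rule integral_pos_open [OF _ _ assms(1,2)])
    show "integrable lborel (\<lambda>y. heat_kernel h (x - y) * (1 + w y))"
      unfolding distrib_left mult_1_right
      by (intro Bochner_Integration.integrable_add integrable_heat_conv integrable_heat_kernel_reflect [OF h])
    show "heat_kernel h (x - y) * (1 + w y) \<ge> 0" for y
      using w [of y] by (auto intro!: mult_nonneg_nonneg heat_kernel_nonneg)
    show "heat_kernel h (x - y) * (1 + w y) > 0" if "y \<in> U" for y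
      using assms(3) [OF that] by (auto intro!: mult_pos_pos heat_kernel_pos [OF h])
  qed
  also have "\<dots> = 1 + heat_conv h w x"
    using integrable_heat_conv [of x] integrable_heat_kernel_reflect [OF h, of x]
      integral_heat_kernel_reflect [OF h, of x]
    by (simp add: distrib_left heat_conv_def)
  finally show ?thesis
    by simp
qed

lemma isCont_heat_conv: "isCont (heat_conv h w) x"
proof (rule continuous_at_sequentiallyI)
  fix u assume u: "u \<longlonglongrightarrow> x"
  then have "Bseq (\<lambda>n. u n - x)"
    using Bseq_add [of u "- x"] convergent_imp_Bseq [of u] by (auto simp: convergent_def)
  then obtain B where B: "\<And>n. norm (u n - x) \<le> B"
    by (auto simp: Bseq_def)
  \<comment> \<open>Dominates the kernels centred at \<open>u n\<close> by one kernel at the doubled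
    time. The exponential factor comes from \<open>(norm (x - y))\<^sup>2 \<le> 2 * (norm (u n -
    y))\<^sup>2 + 2 * B\<^sup>2\<close>, the quotient from the two normalizing constants.\<close>
  define C where "C = (4 * pi * h) powr (- real CARD('d) / 2) / (4 * pi * (2 * h)) powr (- real CARD('d) / 2)
    * exp (B\<^sup>2 / (4 * h))"
  have bound: "heat_kernel h (u n - y) \<le> C * heat_kernel (2 * h) (x - y)" for n y
  proof -
    have "(norm (x - y))\<^sup>2 \<le> (norm (u n - y) + B)\<^sup>2"
      using norm_triangle_ineq4 [of "u n - y" "u n - x"] B [of n]
      by (intro power_mono) auto
    also have "\<dots> \<le> 2 * (norm (u n - y))\<^sup>2 + 2 * B\<^sup>2"
      using sum_squares_bound [of "norm (u n - y)" B] by (simp add: power2_sum)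
    finally have "- (norm (u n - y))\<^sup>2 / (4 * h) \<le> B\<^sup>2 / (4 * h) + - (norm (x - y))\<^sup>2 / (4 * (2 * h))"
      using h by (simp add: field_simps)
    then have "exp (- (norm (u n - y))\<^sup>2 / (4 * h)) \<le> exp (B\<^sup>2 / (4 * h)) * exp (- (norm (x - y))\<^sup>2 / (4 * (2 * h)))"
      by (simp flip: exp_add)
    then show ?thesis
      using h by (simp add: heat_kernel_def C_def mult_left_mono)
  qed
  have "(\<lambda>n. \<integral>y. heat_kernel h (u n - y) * w y \<partial>lborel) \<longlonglongrightarrow> (\<integral>y. heat_kernel h (x - y) * w y \<partial>lborel)"
  proof (rule integral_dominated_convergence)
    show "integrable lborel (\<lambda>y. C * heat_kernel (2 * h) (x - y))"
      using h by (intro integrable_mult_right integrable_heat_kernel_reflect) auto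
    show "AE y in lborel. norm (heat_kernel h (u n - y) * w y) \<le> C * heat_kernel (2 * h) (x - y)" for n
    proof (rule AE_I2)
      fix y
      have "heat_kernel h (u n - y) * \<bar>w y\<bar> \<le> heat_kernel h (u n - y)"
        by (intro mult_left_le w heat_kernel_nonneg)
      then show "norm (heat_kernel h (u n - y) * w y) \<le> C * heat_kernel (2 * h) (x - y)"
        using bound [of n y] by (simp add: abs_mult heat_kernel_nonneg)
    qed
    show "AE y in lborel. (\<lambda>n. heat_kernel h (u n - y) * w y) \<longlonglongrightarrow> heat_kernel h (x - y) * w y"
      unfolding heat_kernel_def using h by (intro AE_I2 tendsto_intros u) auto
  qed auto
  then show "(\<lambda>n. heat_conv h w (u n)) \<longlonglongrightarrow> heat_conv h w x"
    by (simp add: heat_conv_def)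
qed

text \<open>Expanding the square separates a factor quadratic in \<open>t\<close> and free of
  \<open>y\<close> from one whose exponent is linear in \<open>t\<close>. Along a line the
  convolution thus becomes a moment integral of the form studied above.\<close>

lemma heat_kernel_line:
  "heat_kernel h (p + t *\<^sub>R \<xi> - y) =
    exp (- t\<^sup>2 * (norm \<xi>)\<^sup>2 / (4 * h)) * (heat_kernel h (p - y) * exp (t * (- ((p - y) \<bullet> \<xi>) / (2 * h))))"
proof -
  have "(norm (p + t *\<^sub>R \<xi> - y))\<^sup>2 = (norm (p - y))\<^sup>2 + 2 * t * ((p - y) \<bullet> \<xi>) + t\<^sup>2 * (norm \<xi>)\<^sup>2"
    unfolding power2_norm_eq_inner
    by (simp add: inner_add_left inner_add_right inner_diff_left inner_diff_right inner_commute
        algebra_simps power2_eq_square)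
  then have "- (norm (p + t *\<^sub>R \<xi> - y))\<^sup>2 / (4 * h) =
      - t\<^sup>2 * (norm \<xi>)\<^sup>2 / (4 * h) + (- (norm (p - y))\<^sup>2 / (4 * h) + t * (- ((p - y) \<bullet> \<xi>) / (2 * h)))"
    using h by (simp add: field_simps)
  then show ?thesis
    unfolding heat_kernel_def by (simp only: exp_add mult_ac)
qed

text \<open>The factor in front is a nonzero constant in \<open>y\<close>, so integrability for
  every \<open>t\<close> is inherited from the convolution at the shifted point.\<close>

lemma
  shows integrable_heat_line:
      "integrable lborel (\<lambda>y. heat_kernel h (p - y) * w y * exp (t * (- ((p - y) \<bullet> \<xi>) / (2 * h))))"
    and heat_conv_line: "heat_conv h w (p + t *\<^sub>R \<xi>) = exp (- t\<^sup>2 * (norm \<xi>)\<^sup>2 / (4 * h)) *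
      (\<integral>y. heat_kernel h (p - y) * w y * exp (t * (- ((p - y) \<bullet> \<xi>) / (2 * h))) \<partial>lborel)"
proof -
  have eq: "heat_kernel h (p + t *\<^sub>R \<xi> - y) * w y = exp (- t\<^sup>2 * (norm \<xi>)\<^sup>2 / (4 * h)) *
      (heat_kernel h (p - y) * w y * exp (t * (- ((p - y) \<bullet> \<xi>) / (2 * h))))" for y
    unfolding heat_kernel_line by (simp only: mult_ac)
  show "integrable lborel (\<lambda>y. heat_kernel h (p - y) * w y * exp (t * (- ((p - y) \<bullet> \<xi>) / (2 * h))))"
    using integrable_heat_conv [of "p + t *\<^sub>R \<xi>"] unfolding eq by simp
  show "heat_conv h w (p + t *\<^sub>R \<xi>) = exp (- t\<^sup>2 * (norm \<xi>)\<^sup>2 / (4 * h)) *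
      (\<integral>y. heat_kernel h (p - y) * w y * exp (t * (- ((p - y) \<bullet> \<xi>) / (2 * h))) \<partial>lborel)"
    unfolding heat_conv_def eq by (rule integral_mult_right_zero)
qed

lemma heat_conv_AE_nonzero:
  assumes "heat_conv h w p \<noteq> 0"
  shows "AE x in lborel. heat_conv h w x \<noteq> 0"
proof -
  have "AE t in lborel. heat_conv h w (p + t *\<^sub>R \<xi>) \<noteq> 0" for \<xi>
  proof -
    \<comment> \<open>The nonzero value required is the one at parameter 0, where the integral is
      \<open>heat_conv h w p\<close>.\<close>
    have "countable {t. (\<integral>y. heat_kernel h (p - y) * w y * exp (t * (- ((p - y) \<bullet> \<xi>) / (2 * h))) \<partial>lborel) = 0}"
      using assms heat_conv_line [of p 0 \<xi>]
      by (intro exp_moment_countable_zeros [of _ _ _ 0] integrable_heat_line) auto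
    then have "countable {t. heat_conv h w (p + t *\<^sub>R \<xi>) = 0}"
      by (simp add: heat_conv_line)
    from countable_imp_null_set_lborel [OF this] show ?thesis
      by (auto intro: AE_I')
  qed
  then have "AE \<xi> in lborel. AE t in lborel. heat_conv h w (p + t *\<^sub>R \<xi>) \<noteq> 0"
    by simp
  then have "AE t in lborel. AE \<xi> in lborel. heat_conv h w (p + t *\<^sub>R \<xi>) \<noteq> 0"
    by (subst lborel_pair.AE_commute) measurable
  \<comment> \<open>One good \<open>t\<close> suffices, but it must differ from 0: then the map from
    \<open>\<xi>\<close> to \<open>p + t *\<^sub>R \<xi>\<close> is an invertible affine map, and
    \<open>lborel_affine\<close> turns "almost every direction" into "almost every point".\<close>
  then have "AE t in (lborel :: real measure). t \<noteq> 0 \<and> (AE \<xi> in lborel. heat_conv h w (p + t *\<^sub>R \<xi>) \<noteq> 0)"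
    using AE_lborel_singleton [of "0 :: real"] by (rule eventually_conj [rotated])
  moreover have "ae_filter (lborel :: real measure) \<noteq> bot"
    by (simp add: ae_filter_eq_bot_iff)
  ultimately obtain t :: real where "t \<noteq> 0" and t: "AE \<xi> in lborel. heat_conv h w (p + t *\<^sub>R \<xi>) \<noteq> 0"
    using eventually_happens' by blast
  show ?thesis
    by (subst lborel_affine [OF \<open>t \<noteq> 0\<close>, of p]) (use t in \<open>auto simp: AE_density AE_distr_iff\<close>)
qed

text \<open>Vanishing along all lines through \<open>p\<close> kills the real exponential integrals,
  hence the cosine integrals at every frequency. Averaging these over frequencies with a Gaussian
  weight gives the claim, since the cosine transform of that weight is again a Gaussian.\<close>

lemma heat_conv_zero_imp_gaussian_zero:
  assumes zero: "\<And>x. heat_conv h w x = 0" and s: "s > 0"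
  shows "(\<integral>y. heat_kernel h (p - y) * w y * exp (- s * (norm (p - y))\<^sup>2) \<partial>lborel) = 0"
proof -
  have cos_zero: "(\<integral>y. heat_kernel h (p - y) * w y * cos ((p - y) \<bullet> \<xi>) \<partial>lborel) = 0" for \<xi>
  proof -
    \<comment> \<open>The direction is scaled by \<open>2 * h\<close> to cancel the denominator of
      \<open>heat_kernel_line\<close>; the sign disappears because cosine is even.\<close>
    have "(\<integral>y. heat_kernel h (p - y) * w y * cos (- ((p - y) \<bullet> ((2 * h) *\<^sub>R \<xi>)) / (2 * h)) \<partial>lborel) = 0"
      using heat_conv_line [of p _ "(2 * h) *\<^sub>R \<xi>"] zero
      by (intro laplace_zero_imp_cos_zero integrable_heat_line) auto
    then show ?thesis
      using h by simp
  qed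
  let ?f = "\<lambda>(\<xi>, y). heat_kernel s \<xi> * (heat_kernel h (p - y) * w y * cos ((p - y) \<bullet> \<xi>))"
  have int_y: "integrable lborel (\<lambda>y. heat_kernel h (p - y) * w y * cos ((p - y) \<bullet> \<xi>))" for \<xi>
    by (rule Bochner_Integration.integrable_bound [OF integrable_heat_conv [of p]])
      (auto simp: abs_mult intro!: mult_left_le)
  \<comment> \<open>Fubini applies because the absolute value is at most the product of two heat
    kernels, one in each variable.\<close>
  have "integrable (lborel \<Otimes>\<^sub>M lborel) ?f"
  proof (rule lborel_pair.Fubini_integrable)
    show "integrable lborel (\<lambda>\<xi>. \<integral>y. norm (?f (\<xi>, y)) \<partial>lborel)"
    proof (rule Bochner_Integration.integrable_bound [OF integrable_heat_kernel [OF s]])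
      show "AE \<xi> in lborel. norm (\<integral>y. norm (?f (\<xi>, y)) \<partial>lborel) \<le> norm (heat_kernel s \<xi>)"
      proof (rule AE_I2)
        fix \<xi> :: "real ^ 'd"
        have "\<bar>w y\<bar> * \<bar>cos ((p - y) \<bullet> \<xi>)\<bar> \<le> 1 * 1" for y
          by (rule mult_mono) (auto simp: w)
        then have "norm (?f (\<xi>, y)) \<le> heat_kernel s \<xi> * heat_kernel h (p - y)" for y
          by (auto simp: abs_mult heat_kernel_nonneg mult.assoc intro!: mult_left_mono mult_left_le)
        moreover have "integrable lborel (\<lambda>y. ?f (\<xi>, y))"
          using int_y [of \<xi>] by simp
        ultimately have "(\<integral>y. norm (?f (\<xi>, y)) \<partial>lborel) \<le> (\<integral>y. heat_kernel s \<xi> * heat_kernel h (p - y) \<partial>lborel)"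
          using integrable_heat_kernel_reflect [OF h, of p] by (intro integral_mono integrable_norm) auto
        then show "norm (\<integral>y. norm (?f (\<xi>, y)) \<partial>lborel) \<le> norm (heat_kernel s \<xi>)"
          by (simp add: integral_heat_kernel_reflect [OF h] heat_kernel_nonneg)
      qed
    qed measurable
  qed (use int_y in auto)
  then have "(\<integral>y. (\<integral>\<xi>. ?f (\<xi>, y) \<partial>lborel) \<partial>lborel) = (\<integral>\<xi>. (\<integral>y. ?f (\<xi>, y) \<partial>lborel) \<partial>lborel)"
    by (intro lborel_pair.Fubini_integral) (simp add: case_prod_beta)
  also have "\<dots> = 0"
    by (simp add: cos_zero)
  finally have "(\<integral>y. (\<integral>\<xi>. ?f (\<xi>, y) \<partial>lborel) \<partial>lborel) = 0" .
  moreover have "(\<integral>\<xi>. ?f (\<xi>, y) \<partial>lborel) = heat_kernel h (p - y) * w y * exp (- s * (norm (p - y))\<^sup>2)" for y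
  proof -
    have "(\<integral>\<xi>. ?f (\<xi>, y) \<partial>lborel) =
        (\<integral>\<xi>. (heat_kernel h (p - y) * w y) * (heat_kernel s \<xi> * cos ((p - y) \<bullet> \<xi>)) \<partial>lborel)"
      by (simp only: prod.case mult_ac)
    then show ?thesis
      by (simp only: integral_mult_right_zero integral_heat_kernel_cos [OF s])
  qed
  ultimately show ?thesis
    by simp
qed

text \<open>
  Averaged against ever narrower Gaussians centred in a ball where \<open>w\<close> is constant, the values of
  \<open>w\<close> outside of the ball become negligible.
\<close>

lemma heat_conv_not_zero:
  assumes c: "\<bar>c\<bar> = 1" and r: "r > 0" and const: "\<And>y. y \<in> ball p r \<Longrightarrow> w y = c"
  shows "\<exists>x. heat_conv h w x \<noteq> 0"
proof (rule ccontr)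
  assume "\<not> ?thesis"
  then have zero: "\<And>x. heat_conv h w x = 0"
    by simp
  let ?K = "\<lambda>y. heat_kernel h (p - y)"
  define m where "m = (\<integral>y. ?K y * indicator (ball p (r / 2)) y \<partial>lborel)"
  have int_m: "integrable lborel (\<lambda>y. ?K y * indicator (ball p (r / 2)) y)"
    by (rule Bochner_Integration.integrable_bound [OF integrable_heat_kernel_reflect [OF h, of p]])
      (auto simp: indicator_def)
  have "m > 0"
    unfolding m_def using r
    by (intro integral_pos_open [of _ "ball p (r / 2)"] int_m) (auto simp: heat_kernel_nonneg heat_kernel_pos [OF h])
  \<comment> \<open>The Gaussian is at least \<open>exp (- s * (r / 2)\<^sup>2)\<close> on the half
    ball and at most \<open>exp (- s * r\<^sup>2)\<close> outside the full ball. As the average of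
    \<open>w\<close> is 0, the outside must balance the inside, and the quotient of the two bounds
    is the right-hand side.\<close>
  have m_le: "m \<le> exp (- s * (3 * r\<^sup>2 / 4))" if "s > 0" for s
  proof -
    define g where "g y = ?K y * w y * exp (- s * (norm (p - y))\<^sup>2)" for y
    have int_g: "integrable lborel g"
      unfolding g_def using that
      by (intro Bochner_Integration.integrable_bound [OF integrable_heat_conv [of p]])
        (auto simp: abs_mult intro!: mult_left_le)
    \<comment> \<open>Inside the large ball \<open>c * w\<close> equals 1, so \<open>c * g\<close>
      is nonnegative; outside, \<open>\<bar>c * g\<bar>\<close> is absorbed by the last
      term.\<close>
    have "exp (- s * (r / 2)\<^sup>2) * (?K y * indicator (ball p (r / 2)) y) \<le> c * g y + exp (- s * r\<^sup>2) * ?K y" for y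
    proof (cases "y \<in> ball p r")
      case True
      have cg: "c * g y = ?K y * exp (- s * (norm (p - y))\<^sup>2)"
        using c const [OF True] by (auto simp: g_def abs_if split: if_splits)
      have "exp (- s * (r / 2)\<^sup>2) \<le> exp (- s * (norm (p - y))\<^sup>2)" if "y \<in> ball p (r / 2)"
        using that \<open>s > 0\<close> by (auto simp: dist_norm intro!: mult_left_mono power_mono)
      then show ?thesis
        using heat_kernel_nonneg [of h "p - y"]
        by (auto simp: cg indicator_def mult.commute intro!: add_increasing2 mult_left_mono)
    next
      case False
      then have "exp (- s * (norm (p - y))\<^sup>2) \<le> exp (- s * r\<^sup>2)"
        using \<open>s > 0\<close> r by (auto simp: dist_norm intro!: mult_left_mono power_mono)
      then have "\<bar>w y\<bar> * exp (- s * (norm (p - y))\<^sup>2) \<le> 1 * exp (- s * r\<^sup>2)"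
        by (intro mult_mono w) auto
      then have "\<bar>c * g y\<bar> \<le> exp (- s * r\<^sup>2) * ?K y"
        using c heat_kernel_nonneg [of h "p - y"]
        by (simp add: g_def abs_mult mult.assoc mult.commute [of _ "?K y"] mult_left_mono)
      moreover have "y \<notin> ball p (r / 2)"
        using False r by auto
      ultimately show ?thesis
        by simp
    qed
    then have "(\<integral>y. exp (- s * (r / 2)\<^sup>2) * (?K y * indicator (ball p (r / 2)) y) \<partial>lborel)
        \<le> (\<integral>y. c * g y + exp (- s * r\<^sup>2) * ?K y \<partial>lborel)"
      using int_m int_g integrable_heat_kernel_reflect [OF h, of p] by (intro integral_mono) auto
    also have "\<dots> = c * (\<integral>y. g y \<partial>lborel) + exp (- s * r\<^sup>2)"
      using int_g integrable_heat_kernel_reflect [OF h, of p] integral_heat_kernel_reflect [OF h, of p]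
      by simp
    also have "(\<integral>y. g y \<partial>lborel) = 0"
      unfolding g_def by (rule heat_conv_zero_imp_gaussian_zero [OF zero that])
    finally have "exp (- s * (r / 2)\<^sup>2) * m \<le> exp (- s * r\<^sup>2)"
      by (simp add: m_def)
    also have "exp (- s * r\<^sup>2) = exp (- s * (r / 2)\<^sup>2) * exp (- s * (3 * r\<^sup>2 / 4))"
      by (simp add: power2_eq_square flip: exp_add)
    finally show ?thesis
      by simp
  qed
  \<comment> \<open>Chosen to make the bound on \<open>m\<close> equal to
    \<open>exp (- (\<bar>ln m\<bar> + 1))\<close>, which is smaller than \<open>m\<close>.\<close>
  define s where "s = (\<bar>ln m\<bar> + 1) / (3 * r\<^sup>2 / 4)"
  have s: "s > 0" "s * (3 * r\<^sup>2 / 4) = \<bar>ln m\<bar> + 1"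
    using r by (auto simp: s_def)
  have "m \<le> exp (- (\<bar>ln m\<bar> + 1))"
    using m_le [OF s(1)] by (simp only: mult_minus_left s(2))
  then have "ln m \<le> ln (exp (- (\<bar>ln m\<bar> + 1)))"
    using \<open>m > 0\<close> by (intro ln_mono) auto
  then show False
    by simp
qed

end


section \<open>Passing from weak to strong convergence for sign-valued functions, and through the
  sign\<close>

section \<open>Strong and weak convergence in \<open>L\<^sup>2\<close>\<close>

lemma L2_mult_integrable:
  assumes "f \<in> L2 M" "g \<in> L2 M"
  shows "integrable M (\<lambda>x. f x * g x)"
proof (rule Bochner_Integration.integrable_bound)
  show "integrable M (\<lambda>x. (f x)\<^sup>2 + (g x)\<^sup>2)"
    using assms by (auto simp: L2_def)
  have "2 * \<bar>a * b\<bar> \<le> a\<^sup>2 + b\<^sup>2" for a b :: real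
    using sum_squares_bound [of "\<bar>a\<bar>" "\<bar>b\<bar>"] by (simp add: abs_mult)
  then have "\<bar>a * b\<bar> \<le> a\<^sup>2 + b\<^sup>2" for a b :: real
    using abs_ge_zero [of "a * b"] by (smt (verit))
  then show "AE x in M. norm (f x * g x) \<le> norm ((f x)\<^sup>2 + (g x)\<^sup>2)"
    by simp
qed (use assms in \<open>auto simp: L2_def\<close>)

lemma L2_cmult:
  assumes "f \<in> L2 M"
  shows "(\<lambda>x. c * f x) \<in> L2 M"
  using assms by (auto simp: L2_def power_mult_distrib)

lemma L2_add:
  assumes f: "f \<in> L2 M" and g: "g \<in> L2 M"
  shows "(\<lambda>x. f x + g x) \<in> L2 M"
proof -
  have "integrable M (\<lambda>x. (f x)\<^sup>2 + (g x)\<^sup>2 + 2 * (f x * g x))"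
    using L2_mult_integrable [OF f g] f g
    by (intro Bochner_Integration.integrable_add integrable_mult_right) (auto simp: L2_def)
  then show ?thesis
    using f g by (auto simp: L2_def power2_sum mult.assoc)
qed

lemma L2_diff: "f \<in> L2 M \<Longrightarrow> g \<in> L2 M \<Longrightarrow> (\<lambda>x. f x - g x) \<in> L2 M"
  using L2_add [of f M "\<lambda>x. - 1 * g x"] L2_cmult [of g M "- 1"] by simp

lemma (in finite_measure) L2_bounded:
  assumes "f \<in> borel_measurable M" "\<And>x. x \<in> space M \<Longrightarrow> \<bar>f x\<bar> \<le> 1"
  shows "f \<in> L2 M"
proof -
  have "integrable M (\<lambda>x. (f x)\<^sup>2)"
    by (rule integrable_const_bound [of _ 1]) (use assms in \<open>auto simp: abs_square_le_1\<close>)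
  with assms show ?thesis
    by (simp add: L2_def)
qed

lemma L2_converges_iff:
  "L2_converges M f f0 \<longleftrightarrow> (\<forall>\<^sub>F n in sequentially. f n \<in> L2 M) \<and> f0 \<in> L2 M \<and>
     (\<lambda>n. \<integral>x. (f n x - f0 x)\<^sup>2 \<partial>M) \<longlonglongrightarrow> 0"
proof -
  have "(\<lambda>n. sqrt (a n)) \<longlonglongrightarrow> 0 \<longleftrightarrow> a \<longlonglongrightarrow> 0" if "\<And>n. a n \<ge> 0" for a :: "nat \<Rightarrow> real"
    using that tendsto_power [of "\<lambda>n. sqrt (a n)" 0 sequentially 2] tendsto_real_sqrt [of a 0]
    by auto
  then show ?thesis
    by (simp add: L2_converges_def)
qed

lemma L2_converges_add:
  assumes f: "L2_converges M f f0" and g: "L2_converges M g g0"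
  shows "L2_converges M (\<lambda>n x. f n x + g n x) (\<lambda>x. f0 x + g0 x)"
  unfolding L2_converges_iff
proof (intro conjI)
  have ev: "\<forall>\<^sub>F n in sequentially. f n \<in> L2 M \<and> g n \<in> L2 M" and f0: "f0 \<in> L2 M" and g0: "g0 \<in> L2 M"
    using f g by (auto simp: L2_converges_def eventually_conj_iff)
  then show "\<forall>\<^sub>F n in sequentially. (\<lambda>x. f n x + g n x) \<in> L2 M"
    by (auto elim: eventually_mono intro: L2_add)
  show "(\<lambda>x. f0 x + g0 x) \<in> L2 M"
    using f0 g0 by (rule L2_add)
  have lim: "(\<lambda>n. 2 * (\<integral>x. (f n x - f0 x)\<^sup>2 \<partial>M) + 2 * (\<integral>x. (g n x - g0 x)\<^sup>2 \<partial>M)) \<longlonglongrightarrow> 0"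
    using f g by (intro tendsto_eq_intros) (auto simp: L2_converges_iff)
  have upper: "\<forall>\<^sub>F n in sequentially. (\<integral>x. (f n x + g n x - (f0 x + g0 x))\<^sup>2 \<partial>M) \<le>
      2 * (\<integral>x. (f n x - f0 x)\<^sup>2 \<partial>M) + 2 * (\<integral>x. (g n x - g0 x)\<^sup>2 \<partial>M)"
    using ev
  proof eventually_elim
    case (elim n)
    then have df: "(\<lambda>x. f n x - f0 x) \<in> L2 M" and dg: "(\<lambda>x. g n x - g0 x) \<in> L2 M"
      using f0 g0 by (auto intro: L2_diff)
    have "(a + b - (c + d))\<^sup>2 \<le> 2 * (a - c)\<^sup>2 + 2 * (b - d)\<^sup>2" for a b c d :: real
      using sum_squares_bound [of "a - c" "b - d"] power2_sum [of "a - c" "b - d"]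
      by (simp add: algebra_simps)
    then have "(\<integral>x. (f n x + g n x - (f0 x + g0 x))\<^sup>2 \<partial>M) \<le>
        (\<integral>x. 2 * (f n x - f0 x)\<^sup>2 + 2 * (g n x - g0 x)\<^sup>2 \<partial>M)"
      using df dg L2_add [OF df dg]
      by (intro integral_mono) (auto simp: L2_def algebra_simps)
    also have "\<dots> = 2 * (\<integral>x. (f n x - f0 x)\<^sup>2 \<partial>M) + 2 * (\<integral>x. (g n x - g0 x)\<^sup>2 \<partial>M)"
      using df dg by (subst Bochner_Integration.integral_add) (auto simp: L2_def)
    finally show ?case .
  qed
  show "(\<lambda>n. \<integral>x. (f n x + g n x - (f0 x + g0 x))\<^sup>2 \<partial>M) \<longlonglongrightarrow> 0"
    by (rule tendsto_sandwich [OF _ upper tendsto_const lim]) (simp add: always_eventually)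
qed

lemma L2_converges_cmult:
  assumes f: "L2_converges M f f0"
  shows "L2_converges M (\<lambda>n x. c * f n x) (\<lambda>x. c * f0 x)"
proof -
  have "(\<integral>x. (c * f n x - c * f0 x)\<^sup>2 \<partial>M) = c\<^sup>2 * (\<integral>x. (f n x - f0 x)\<^sup>2 \<partial>M)" for n
    by (simp add: power_mult_distrib flip: right_diff_distrib)
  moreover have "(\<lambda>n. c\<^sup>2 * (\<integral>x. (f n x - f0 x)\<^sup>2 \<partial>M)) \<longlonglongrightarrow> c\<^sup>2 * 0"
    using f by (intro tendsto_mult_left) (simp add: L2_converges_iff)
  ultimately show ?thesis
    using f by (auto simp: L2_converges_iff intro: L2_cmult elim: eventually_mono)
qed

lemma L2_converges_cong:
  assumes f: "L2_converges M f f0"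
    and "\<forall>\<^sub>F n in sequentially. \<forall>x\<in>space M. f n x = g n x" and f0: "\<And>x. x \<in> space M \<Longrightarrow> f0 x = g0 x"
  shows "L2_converges M g g0"
proof -
  have L2: "u \<in> L2 M \<longleftrightarrow> v \<in> L2 M" if "\<forall>x\<in>space M. u x = v x" for u v :: "'a \<Rightarrow> real"
    unfolding L2_def mem_Collect_eq
    using that by (intro conj_cong measurable_cong Bochner_Integration.integrable_cong) auto
  have "\<forall>\<^sub>F n in sequentially. f n \<in> L2 M"
    using f by (simp add: L2_converges_iff)
  with assms(2) have "\<forall>\<^sub>F n in sequentially. g n \<in> L2 M"
    by eventually_elim (metis L2)
  moreover have "g0 \<in> L2 M"
    using f f0 L2 [of f0 g0] by (simp add: L2_converges_iff)
  moreover have "(\<lambda>n. \<integral>x. (g n x - g0 x)\<^sup>2 \<partial>M) \<longlonglongrightarrow> 0"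
  proof (rule Lim_transform_eventually)
    show "(\<lambda>n. \<integral>x. (f n x - f0 x)\<^sup>2 \<partial>M) \<longlonglongrightarrow> 0"
      using f by (simp add: L2_converges_iff)
    show "\<forall>\<^sub>F n in sequentially. (\<integral>x. (f n x - f0 x)\<^sup>2 \<partial>M) = (\<integral>x. (g n x - g0 x)\<^sup>2 \<partial>M)"
      using assms(2) by eventually_elim (auto intro!: Bochner_Integration.integral_cong simp: f0)
  qed
  ultimately show ?thesis
    by (simp add: L2_converges_iff)
qed

text \<open>Instead of Cauchy-Schwarz, Young's inequality with a free weight \<open>e\<close> splits
  the error into a part that tends to 0 and a part of size \<open>e * G\<close>.\<close>

lemma L2_converges_imp_weakly:
  assumes f: "L2_converges M f f0"
  shows "L2_weakly_converges M f f0"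
  unfolding L2_weakly_converges_def
proof (intro conjI ballI)
  have ev: "\<forall>\<^sub>F n in sequentially. f n \<in> L2 M" and f0: "f0 \<in> L2 M"
    and lim: "(\<lambda>n. \<integral>x. (f n x - f0 x)\<^sup>2 \<partial>M) \<longlonglongrightarrow> 0"
    using f by (auto simp: L2_converges_iff)
  then show "\<forall>\<^sub>F n in sequentially. f n \<in> L2 M" "f0 \<in> L2 M"
    by auto
  fix g assume g: "g \<in> L2 M"
  define G where "G = (\<integral>x. (g x)\<^sup>2 \<partial>M)"
  have "G \<ge> 0"
    by (simp add: G_def)
  have young: "\<bar>(\<integral>x. f n x * g x \<partial>M) - (\<integral>x. f0 x * g x \<partial>M)\<bar> \<le>
      (\<integral>x. (f n x - f0 x)\<^sup>2 \<partial>M) / e + e * G" if "f n \<in> L2 M" "e > 0" for n e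
  proof -
    have d: "(\<lambda>x. f n x - f0 x) \<in> L2 M"
      using that(1) f0 by (rule L2_diff)
    have "2 * \<bar>a * b\<bar> \<le> a\<^sup>2 / e + e * b\<^sup>2" for a b :: real
      using sum_squares_bound [of "\<bar>a\<bar> / sqrt e" "sqrt e * \<bar>b\<bar>"] \<open>e > 0\<close>
      by (simp add: power_divide power_mult_distrib abs_mult)
    then have "\<bar>a * b\<bar> \<le> a\<^sup>2 / e + e * b\<^sup>2" for a b :: real
      using abs_ge_zero [of "a * b"] by (smt (verit))
    then have "(\<integral>x. \<bar>(f n x - f0 x) * g x\<bar> \<partial>M) \<le> (\<integral>x. (f n x - f0 x)\<^sup>2 / e + e * (g x)\<^sup>2 \<partial>M)"
      using d g L2_mult_integrable [OF d g] by (intro integral_mono integrable_abs) (auto simp: L2_def)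
    also have "\<dots> = (\<integral>x. (f n x - f0 x)\<^sup>2 \<partial>M) / e + e * G"
      using d g by (subst Bochner_Integration.integral_add) (auto simp: L2_def G_def)
    finally have "\<bar>\<integral>x. (f n x - f0 x) * g x \<partial>M\<bar> \<le> (\<integral>x. (f n x - f0 x)\<^sup>2 \<partial>M) / e + e * G"
      using integral_abs_bound [of M "\<lambda>x. (f n x - f0 x) * g x"] by linarith
    then show ?thesis
      using L2_mult_integrable [OF that(1) g] L2_mult_integrable [OF f0 g]
      by (simp add: left_diff_distrib)
  qed
  show "(\<lambda>n. \<integral>x. f n x * g x \<partial>M) \<longlonglongrightarrow> (\<integral>x. f0 x * g x \<partial>M)"
  proof (rule tendstoI)
    fix \<epsilon> :: real assume "\<epsilon> > 0"
    \<comment> \<open>The summand 1 covers the case \<open>G = 0\<close>.\<close>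
    define e where "e = \<epsilon> / (2 * (G + 1))"
    have "e > 0" "e * G < \<epsilon> / 2"
      using \<open>\<epsilon> > 0\<close> \<open>G \<ge> 0\<close> by (auto simp: e_def field_simps)
    have "\<forall>\<^sub>F n in sequentially. (\<integral>x. (f n x - f0 x)\<^sup>2 \<partial>M) < e * (\<epsilon> / 2)"
      using lim \<open>e > 0\<close> \<open>\<epsilon> > 0\<close> by (intro order_tendstoD) auto
    with ev show "\<forall>\<^sub>F n in sequentially. dist (\<integral>x. f n x * g x \<partial>M) (\<integral>x. f0 x * g x \<partial>M) < \<epsilon>"
    proof eventually_elim
      case (elim n)
      then have "(\<integral>x. (f n x - f0 x)\<^sup>2 \<partial>M) / e < \<epsilon> / 2"
        using \<open>e > 0\<close> by (simp add: field_simps)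
      with young [OF elim(1) \<open>e > 0\<close>] \<open>e * G < \<epsilon> / 2\<close> show ?case
        unfolding dist_real_def by linarith
    qed
  qed
qed

text \<open>For values of modulus 1, \<open>(f n - f0)\<^sup>2 = 2 - 2 * (f n * f0)\<close>. Testing
  the weak convergence against \<open>f0\<close> itself sends the integral of this to 0.\<close>

lemma (in finite_measure) L2_weakly_converges_sign_imp_converges:
  assumes f: "L2_weakly_converges M f f0"
    and sign: "\<forall>\<^sub>F n in sequentially. \<forall>x\<in>space M. \<bar>f n x\<bar> = 1" "\<And>x. x \<in> space M \<Longrightarrow> \<bar>f0 x\<bar> = 1"
  shows "L2_converges M f f0"
proof -
  have ev: "\<forall>\<^sub>F n in sequentially. f n \<in> L2 M" and f0: "f0 \<in> L2 M"
    using f by (auto simp: L2_weakly_converges_def)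
  have sq: "x\<^sup>2 = 1" if "\<bar>x\<bar> = 1" for x :: real
    using that by (metis power2_abs one_power2)
  have "(\<integral>x. f0 x * f0 x \<partial>M) = (\<integral>x. 1 \<partial>M)"
    using sq sign(2) by (intro Bochner_Integration.integral_cong) (auto simp: power2_eq_square)
  moreover have "(\<lambda>n. \<integral>x. f n x * f0 x \<partial>M) \<longlonglongrightarrow> (\<integral>x. f0 x * f0 x \<partial>M)"
    using f f0 by (auto simp: L2_weakly_converges_def)
  ultimately have "(\<lambda>n. 2 * measure M (space M) - 2 * (\<integral>x. f n x * f0 x \<partial>M)) \<longlonglongrightarrow>
      2 * measure M (space M) - 2 * measure M (space M)"
    by (intro tendsto_intros) simp
  moreover have "\<forall>\<^sub>F n in sequentially. 2 * measure M (space M) - 2 * (\<integral>x. f n x * f0 x \<partial>M) =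
      (\<integral>x. (f n x - f0 x)\<^sup>2 \<partial>M)"
    using ev sign(1)
  proof eventually_elim
    case (elim n)
    have "(\<integral>x. (f n x - f0 x)\<^sup>2 \<partial>M) = (\<integral>x. 2 - 2 * (f n x * f0 x) \<partial>M)"
      using sq sign(2) elim(2) by (intro Bochner_Integration.integral_cong) (auto simp: power2_diff)
    also have "\<dots> = 2 * measure M (space M) - 2 * (\<integral>x. f n x * f0 x \<partial>M)"
      using L2_mult_integrable [OF elim(1) f0] by (subst Bochner_Integration.integral_diff) auto
    finally show ?case
      by simp
  qed
  ultimately have "(\<lambda>n. \<integral>x. (f n x - f0 x)\<^sup>2 \<partial>M) \<longlonglongrightarrow> 0"
    using Lim_transform_eventually by fastforce
  with ev f0 show ?thesis
    by (simp add: L2_converges_iff)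
qed

lemma mbo_sign_measurable [measurable]: "mbo_sign \<in> borel_measurable borel"
  unfolding mbo_sign_def [abs_def] by measurable

lemma abs_mbo_sign [simp]: "\<bar>mbo_sign s\<bar> = 1"
  by (simp add: mbo_sign_def)

text \<open>If the signs of \<open>b n\<close> and \<open>b0\<close> differ, then \<open>\<bar>b n - b0\<bar> \<ge> \<bar>b0\<bar>\<close>.\<close>

lemma (in finite_measure) mbo_sign_L2_converges:
  assumes b: "L2_converges M b b0" and nz: "AE x in M. b0 x \<noteq> 0"
  shows "L2_converges M (\<lambda>n x. mbo_sign (b n x)) (\<lambda>x. mbo_sign (b0 x))"
  unfolding L2_converges_iff
proof (intro conjI)
  have ev: "\<forall>\<^sub>F n in sequentially. b n \<in> L2 M" and b0: "b0 \<in> L2 M"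
    and lim: "(\<lambda>n. \<integral>x. (b n x - b0 x)\<^sup>2 \<partial>M) \<longlonglongrightarrow> 0"
    using b by (auto simp: L2_converges_iff)
  have L2: "(\<lambda>x. mbo_sign (f x)) \<in> L2 M" if "f \<in> L2 M" for f
    using that by (intro L2_bounded) (auto simp: L2_def)
  from ev show "\<forall>\<^sub>F n in sequentially. (\<lambda>x. mbo_sign (b n x)) \<in> L2 M"
    by eventually_elim (rule L2)
  show "(\<lambda>x. mbo_sign (b0 x)) \<in> L2 M"
    by (rule L2 [OF b0])
  have [measurable]: "b0 \<in> borel_measurable M"
    using b0 by (simp add: L2_def)
  \<comment> \<open>These sets decrease to the zero set of \<open>b0\<close>, which is null, so by
    finiteness of the measure their measures tend to 0.\<close>
  define S where "S k = {x \<in> space M. \<bar>b0 x\<bar> \<le> 1 / real (Suc k)}" for k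
  have S [measurable]: "S k \<in> sets M" for k
    unfolding S_def by measurable
  have "(\<lambda>k. measure M (S k)) \<longlonglongrightarrow> measure M (\<Inter>k. S k)"
  proof (rule finite_Lim_measure_decseq)
    show "decseq S"
      unfolding S_def decseq_def by (auto elim!: order_trans intro!: frac_le)
  qed auto
  moreover have "measure M (\<Inter>k. S k) = 0"
  proof -
    have "AE x in M. x \<notin> (\<Inter>k. S k)"
      using nz
    proof eventually_elim
      case (elim x)
      then obtain k where "1 / real (Suc k) < \<bar>b0 x\<bar>"
        using nat_approx_posE [of "\<bar>b0 x\<bar>"] by (metis zero_less_abs_iff)
      then have "x \<notin> S k"
        by (simp add: S_def)
      then show ?case
        by blast
    qed
    then show ?thesis
      by (subst (asm) AE_iff_measurable [of "\<Inter>k. S k"]) (auto simp: S_def measure_def)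
  qed
  ultimately have S0: "(\<lambda>k. measure M (S k)) \<longlonglongrightarrow> 0"
    by simp
  \<comment> \<open>On \<open>S k\<close> the squared difference of signs is at most 4; off
    \<open>S k\<close> a change of sign costs
    \<open>\<bar>b n x - b0 x\<bar> \<ge> 1 / real (Suc k)\<close>, as in Chebyshev's
    inequality.\<close>
  have bound: "(\<integral>x. (mbo_sign (b n x) - mbo_sign (b0 x))\<^sup>2 \<partial>M) \<le>
      4 * measure M (S k) + 4 * (real (Suc k))\<^sup>2 * (\<integral>x. (b n x - b0 x)\<^sup>2 \<partial>M)" if "b n \<in> L2 M" for n k
  proof -
    have d: "integrable M (\<lambda>x. (b n x - b0 x)\<^sup>2)"
      using L2_diff [OF that b0] by (simp add: L2_def)
    have le: "(mbo_sign s - mbo_sign t)\<^sup>2 \<le> 4 * (real (Suc k))\<^sup>2 * (s - t)\<^sup>2"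
      if "\<bar>t\<bar> > 1 / real (Suc k)" for s t
    proof (cases "mbo_sign s = mbo_sign t")
      case False
      then have "1 / real (Suc k) \<le> \<bar>s - t\<bar>"
        using that by (auto simp: mbo_sign_def split: if_splits)
      then have "1 \<le> real (Suc k) * \<bar>s - t\<bar>"
        by (simp add: field_simps)
      then have "1 \<le> (real (Suc k) * \<bar>s - t\<bar>)\<^sup>2"
        by (rule one_le_power)
      moreover have "(mbo_sign s - mbo_sign t)\<^sup>2 = 4"
        using False by (auto simp: mbo_sign_def split: if_splits)
      ultimately show ?thesis
        by (simp only: power_mult_distrib power2_abs)
    qed simp
    have "(mbo_sign s - mbo_sign t)\<^sup>2 \<le> 4" for s t
      by (auto simp: mbo_sign_def)
    then have pw: "(mbo_sign (b n x) - mbo_sign (b0 x))\<^sup>2 \<le>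
        4 * indicator (S k) x + 4 * (real (Suc k))\<^sup>2 * (b n x - b0 x)\<^sup>2" if "x \<in> space M" for x
    proof (cases "x \<in> S k")
      case False
      with that have "1 / real (Suc k) < \<bar>b0 x\<bar>"
        by (simp add: S_def not_le del: of_nat_Suc)
      with False le show ?thesis
        by (simp del: of_nat_Suc)
    qed (auto intro: add_increasing2)
    have int: "integrable M (\<lambda>x. 4 * indicator (S k) x :: real)"
      by (intro integrable_mult_right integrable_real_indicator S) (simp add: emeasure_eq_measure)
    have int': "integrable M (\<lambda>x. 4 * (real (Suc k))\<^sup>2 * (b n x - b0 x)\<^sup>2)"
      using d by (rule integrable_mult_right)
    have "integrable M (\<lambda>x. (mbo_sign (b n x) - mbo_sign (b0 x))\<^sup>2)"
      using L2_diff [OF L2 [OF that] L2 [OF b0]] by (simp add: L2_def)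
    then have "(\<integral>x. (mbo_sign (b n x) - mbo_sign (b0 x))\<^sup>2 \<partial>M) \<le>
        (\<integral>x. 4 * indicator (S k) x + 4 * (real (Suc k))\<^sup>2 * (b n x - b0 x)\<^sup>2 \<partial>M)"
      by (rule integral_mono [OF _ Bochner_Integration.integrable_add [OF int int'] pw])
    also have "\<dots> = 4 * measure M (S k) + 4 * (real (Suc k))\<^sup>2 * (\<integral>x. (b n x - b0 x)\<^sup>2 \<partial>M)"
      by (subst Bochner_Integration.integral_add [OF int int']) simp
    finally show ?thesis .
  qed
  show "(\<lambda>n. \<integral>x. (mbo_sign (b n x) - mbo_sign (b0 x))\<^sup>2 \<partial>M) \<longlonglongrightarrow> 0"
  proof (rule order_tendstoI)
    \<comment> \<open>First \<open>k\<close> is fixed to bring the first term of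
      \<open>bound\<close> below \<open>e / 2\<close>; with this \<open>k\<close>, large
      \<open>n\<close> do the same for the second.\<close>
    fix e :: real assume "e > 0"
    have "\<forall>\<^sub>F k in sequentially. measure M (S k) < e / 8"
      using S0 \<open>e > 0\<close> by (intro order_tendstoD) auto
    then obtain k where k: "measure M (S k) < e / 8"
      by (auto simp: eventually_sequentially)
    have "\<forall>\<^sub>F n in sequentially. (\<integral>x. (b n x - b0 x)\<^sup>2 \<partial>M) < e / (8 * (real (Suc k))\<^sup>2)"
      using lim \<open>e > 0\<close> by (intro order_tendstoD) auto
    with ev show "\<forall>\<^sub>F n in sequentially. (\<integral>x. (mbo_sign (b n x) - mbo_sign (b0 x))\<^sup>2 \<partial>M) < e"
    proof eventually_elim
      case (elim n)
      then have "(\<integral>x. (b n x - b0 x)\<^sup>2 \<partial>M) * (8 * (real (Suc k))\<^sup>2) < e"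
        by (subst (asm) pos_less_divide_eq) auto
      moreover have "4 * K * I = I * (8 * K) / 2" for K I :: real
        by simp
      ultimately have "4 * (real (Suc k))\<^sup>2 * (\<integral>x. (b n x - b0 x)\<^sup>2 \<partial>M) < e / 2"
        by (metis divide_strict_right_mono zero_less_numeral)
      with bound [OF elim(1), of k] k show ?case
        by linarith
    qed
  next
    fix e :: real assume "e < 0"
    moreover have "0 \<le> (\<integral>x. (mbo_sign (b n x) - mbo_sign (b0 x))\<^sup>2 \<partial>M)" for n
      by (intro integral_nonneg_AE) simp
    ultimately show "\<forall>\<^sub>F n in sequentially. e < (\<integral>x. (mbo_sign (b n x) - mbo_sign (b0 x))\<^sup>2 \<partial>M)"
      using less_le_trans by (intro always_eventually allI) blast
  qed
qed


section \<open>Measurability of wrapping, and finite measure of the fundamental cube\<close>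

section \<open>The torus\<close>

lemma wrap_in_torus: "wrap x \<in> torus"
  by (simp add: wrap_def torus_def frac_lt_1)

lemma wrap_torus: "x \<in> torus \<Longrightarrow> wrap x = x"
  by (simp add: wrap_def torus_def vec_eq_iff frac_eq)

lemma wrap_measurable [measurable]: "(wrap :: real ^ 'd \<Rightarrow> real ^ 'd) \<in> borel_measurable borel"
proof -
  have "(\<lambda>x :: real ^ 'd. wrap x \<bullet> axis i 1) \<in> borel_measurable borel" for i :: 'd
    unfolding wrap_def frac_def inner_axis by simp measurable
  then show ?thesis
    by (subst borel_measurable_iff_halfspace_le) (auto simp: Basis_vec_def borel_measurable_iff_halfspace_le)
qed

lemma torus_borel: "(torus :: (real ^ 'd) set) \<in> sets borel"
proof -
  have "{x :: real ^ 'd. 0 \<le> x $ i \<and> x $ i < 1} \<in> sets borel" for i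
    by measurable
  then have "(\<Inter>i. {x :: real ^ 'd. 0 \<le> x $ i \<and> x $ i < 1}) \<in> sets borel"
    by (intro sets.finite_INT) auto
  moreover have "torus = (\<Inter>i. {x :: real ^ 'd. 0 \<le> x $ i \<and> x $ i < 1})"
    by (auto simp: torus_def)
  ultimately show ?thesis
    by simp
qed

lemma torus_lmeasurable: "(torus :: (real ^ 'd) set) \<in> lmeasurable"
proof (rule bounded_set_imp_lmeasurable)
  have "torus \<subseteq> cbox 0 (1 :: real ^ 'd)"
    by (auto simp: torus_def mem_box_cart less_imp_le)
  then show "bounded (torus :: (real ^ 'd) set)"
    by (rule bounded_subset [rotated]) simp
  show "(torus :: (real ^ 'd) set) \<in> sets lebesgue"
    by (rule sets_completionI_sets) (simp add: torus_borel)
qed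

lemma finite_measure_torus: "finite_measure torus_measure"
  by (rule finite_measure_lebesgue_on [OF torus_lmeasurable])

lemma space_torus_measure: "space torus_measure = torus"
  by (simp add: space_restrict_space)

lemma AE_torus_measure:
  assumes "AE x in lborel. P x"
  shows "AE x in torus_measure. P x"
  using AE_completion [OF assms] torus_borel
  by (subst AE_restrict_space_iff) auto


section \<open>An invariant of the limit iterates, and the convergence proof\<close>

section \<open>The obstacle scheme\<close>

lemma lift_set_nonempty: "S \<subseteq> torus \<Longrightarrow> S \<noteq> {} \<Longrightarrow> lift_set S \<noteq> {}"
  using wrap_torus by (metis (no_types, lifting) ex_in_conv lift_set_def mem_Collect_eq subsetD)

locale obstacle_scheme =
  fixes h :: real and \<Phi> \<Psi> :: "(real ^ 'd) set" and u0 :: "real ^ 'd \<Rightarrow> real"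
  assumes h: "h > 0"
    and u0: "\<And>x. x \<in> torus \<Longrightarrow> \<bar>u0 x\<bar> = 1"
    and \<Omega>0: "open (lift_set {x \<in> torus. u0 x = 1})"
    and \<Phi>: "open (lift_set \<Phi>)" "\<Phi> \<subseteq> torus" "\<And>x. x \<in> \<Phi> \<Longrightarrow> u0 x = 1"
    and \<Psi>: "open (lift_set \<Psi>)" "\<Psi> \<subseteq> torus" "\<And>x. x \<in> \<Psi> \<Longrightarrow> u0 x = - 1"
begin

abbreviation u :: "nat \<Rightarrow> real ^ 'd \<Rightarrow> real" where
  "u l \<equiv> continuous_mbo h \<Phi> \<Psi> u0 l"

abbreviation force :: "real ^ 'd \<Rightarrow> real" where
  "force x \<equiv> indicat_real \<Phi> x - indicat_real \<Psi> x"

lemma disjoint: "x \<in> \<Phi> \<Longrightarrow> x \<notin> \<Psi>"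
  using \<Phi>(3) \<Psi>(3) by force

text \<open>The invariant carried along the iteration. The obstacle values keep the semigroup
  strictly above -1 or below 1 when the respective obstacle is nonempty; the open set of constancy
  keeps it from vanishing identically.\<close>

definition admissible :: "(real ^ 'd \<Rightarrow> real) \<Rightarrow> bool" where
  "admissible v \<longleftrightarrow> (v \<circ> wrap) \<in> borel_measurable borel \<and> (\<forall>x\<in>torus. \<bar>v x\<bar> = 1) \<and>
     (\<forall>x\<in>\<Phi>. v x = 1) \<and> (\<forall>x\<in>\<Psi>. v x = - 1) \<and>
     (\<exists>c U. open U \<and> U \<noteq> {} \<and> \<bar>c\<bar> = 1 \<and> (\<forall>y\<in>U. v (wrap y) = c))"

lemma admissible_u0: "admissible u0"
proof -
  let ?O = "lift_set {x \<in> torus. u0 x = 1}"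
  have eq: "u0 (wrap y) = (if y \<in> ?O then 1 else - 1)" for y
    using u0 [OF wrap_in_torus, of y] by (auto simp: lift_set_def wrap_in_torus abs_if split: if_splits)
  have "?O \<in> sets borel"
    using \<Omega>0 by simp
  then have "(u0 \<circ> wrap) \<in> borel_measurable borel"
    unfolding comp_def eq by measurable
  moreover have "\<exists>c U. open U \<and> U \<noteq> {} \<and> \<bar>c\<bar> = 1 \<and> (\<forall>y\<in>U. u0 (wrap y) = c)"
  proof (cases "?O = {}")
    case True
    then show ?thesis
      by (intro exI [of _ "- 1"] exI [of _ UNIV]) (simp add: eq)
  next
    case False
    with \<Omega>0 show ?thesis
      by (intro exI [of _ 1] exI [of _ ?O]) (simp add: eq)
  qed
  ultimately show ?thesis
    using u0 \<Phi>(3) \<Psi>(3) by (auto simp: admissible_def)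
qed

context
  fixes v assumes v: "admissible v"
begin

lemma wrap_bound: "\<bar>(v \<circ> wrap) y\<bar> \<le> 1"
  using v wrap_in_torus [of y] by (auto simp: admissible_def)

lemma lift_measurable [measurable]: "(v \<circ> wrap) \<in> borel_measurable borel"
  using v by (simp add: admissible_def)

lemma semigroup_eq: "heat_semigroup h v = heat_conv h (v \<circ> wrap)"
  by (rule heat_semigroup_eq_heat_conv) measurable

lemma semigroup_measurable [measurable]: "heat_semigroup h v \<in> borel_measurable borel"
  unfolding semigroup_eq by measurable

lemma semigroup_continuous: "continuous_on UNIV (heat_semigroup h v)"
  unfolding semigroup_eq continuous_on_eq_continuous_at [OF open_UNIV]
  using isCont_heat_conv [OF h lift_measurable wrap_bound] by blast

lemma semigroup_gt: "heat_semigroup h v x > - 1" if "\<Phi> \<noteq> {}"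
  unfolding semigroup_eq
  by (rule heat_conv_gt [OF h lift_measurable wrap_bound \<Phi>(1) lift_set_nonempty [OF \<Phi>(2) that]])
    (use v in \<open>auto simp: admissible_def lift_set_def\<close>)

lemma semigroup_less: "heat_semigroup h v x < 1" if "\<Psi> \<noteq> {}"
proof -
  \<comment> \<open>The lower bound is applied to the negated function, which is 1 on the lift of
    \<open>\<Psi>\<close>.\<close>
  have "heat_conv h (\<lambda>y. - (v \<circ> wrap) y) x > - 1"
    by (rule heat_conv_gt [OF h borel_measurable_uminus [OF lift_measurable] _ \<Psi>(1) lift_set_nonempty [OF \<Psi>(2) that]])
      (use v wrap_bound in \<open>auto simp: admissible_def lift_set_def\<close>)
  then show ?thesis
    by (simp add: semigroup_eq heat_conv_def)
qed

lemma semigroup_AE_nonzero: "AE x in lborel. heat_semigroup h v x \<noteq> 0"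
proof -
  obtain c U where U: "open U" "U \<noteq> {}" "\<bar>c\<bar> = 1" "\<And>y. y \<in> U \<Longrightarrow> v (wrap y) = c"
    using v unfolding admissible_def by blast
  then obtain p r where "r > 0" "ball p r \<subseteq> U"
    by (meson all_not_in_conv open_contains_ball)
  then have "\<exists>q. heat_conv h (v \<circ> wrap) q \<noteq> 0"
    using U(4) by (intro heat_conv_not_zero [OF h lift_measurable wrap_bound U(3), of r p]) auto
  then obtain q where "heat_conv h (v \<circ> wrap) q \<noteq> 0"
    by blast
  then show ?thesis
    unfolding semigroup_eq by (rule heat_conv_AE_nonzero [OF h lift_measurable wrap_bound])
qed

lemma step_on_\<Phi>: "heat_semigroup h v x + force x > 0" if "x \<in> \<Phi>"
proof -
  have "force x = 1"
    using that disjoint by simp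
  moreover have "heat_semigroup h v x > - 1"
    using that by (intro semigroup_gt) auto
  ultimately show ?thesis
    by linarith
qed

lemma step_on_\<Psi>: "heat_semigroup h v x + force x < 0" if "x \<in> \<Psi>"
proof -
  have "force x = - 1"
    using that disjoint [of x] by (auto simp: indicator_def)
  moreover have "heat_semigroup h v x < 1"
    using that by (intro semigroup_less) auto
  ultimately show ?thesis
    by linarith
qed

text \<open>On the obstacles the argument of the sign is nonzero at every point; off them the force
  vanishes and only the semigroup remains.\<close>

lemma step_AE_nonzero: "AE x in torus_measure. heat_semigroup h v x + force x \<noteq> 0"
  using AE_torus_measure [OF semigroup_AE_nonzero]
proof eventually_elim
  case (elim x)
  then show ?case
    using step_on_\<Phi> [of x] step_on_\<Psi> [of x] by (cases "x \<in> \<Phi>"; cases "x \<in> \<Psi>") auto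
qed

lemma admissible_step: "admissible (\<lambda>x. mbo_sign (heat_semigroup h v x + force x))" (is "admissible ?v'")
proof -
  have force_wrap: "force (wrap y) = indicat_real (lift_set \<Phi>) y - indicat_real (lift_set \<Psi>) y" for y
    by (simp add: lift_set_def indicator_def)
  have "lift_set \<Phi> \<in> sets borel" "lift_set \<Psi> \<in> sets borel"
    using \<Phi>(1) \<Psi>(1) by auto
  then have "(?v' \<circ> wrap) \<in> borel_measurable borel"
    unfolding comp_def force_wrap by measurable
  moreover have on: "\<forall>x\<in>\<Phi>. ?v' x = 1" "\<forall>x\<in>\<Psi>. ?v' x = - 1"
    using step_on_\<Phi> step_on_\<Psi> by (auto simp: mbo_sign_def not_less intro: less_imp_le)
  moreover have "\<exists>c U. open U \<and> U \<noteq> {} \<and> \<bar>c\<bar> = 1 \<and> (\<forall>y\<in>U. ?v' (wrap y) = c)"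
  proof -
    \<comment> \<open>A nonempty obstacle itself provides the open set on which the new iterate is
      constant. Without obstacles, the sign of a continuous function has to provide it.\<close>
    consider "\<Phi> \<noteq> {}" | "\<Psi> \<noteq> {}" | "\<Phi> = {}" "\<Psi> = {}"
      by blast
    then show ?thesis
    proof cases
      case 1
      then show ?thesis
        using \<Phi>(1) lift_set_nonempty [OF \<Phi>(2)] on(1)
        by (intro exI [of _ 1] exI [of _ "lift_set \<Phi>"]) (auto simp: lift_set_def)
    next
      case 2
      then show ?thesis
        using \<Psi>(1) lift_set_nonempty [OF \<Psi>(2)] on(2)
        by (intro exI [of _ "- 1"] exI [of _ "lift_set \<Psi>"]) (auto simp: lift_set_def)
    next
      case 3
      \<comment> \<open>On the open cube \<open>wrap\<close> is the identity. If the semigroup is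
        positive nowhere there, the new iterate is -1 on the whole cube, since
        \<open>mbo_sign 0 = - 1\<close>.\<close>
      let ?U = "box 0 1 \<inter> {x. heat_semigroup h v x > 0}"
      have v': "?v' (wrap y) = (if heat_semigroup h v y > 0 then 1 else - 1)" if "y \<in> box 0 1" for y
        using that 3 wrap_torus [of y] by (auto simp: mbo_sign_def torus_def mem_box_cart less_imp_le)
      have "open {x. heat_semigroup h v x > 0}"
        using semigroup_continuous by (intro open_Collect_less continuous_intros) auto
      moreover have "box 0 1 \<noteq> ({} :: (real ^ 'd) set)"
        by (simp add: interval_ne_empty_cart)
      ultimately show ?thesis
      proof (cases "?U = {}")
        case True
        then show ?thesis
          using \<open>box 0 1 \<noteq> _\<close> v' by (intro exI [of _ "- 1"] exI [of _ "box 0 1"]) auto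
      next
        case False
        then show ?thesis
          using \<open>open {x. heat_semigroup h v x > 0}\<close> v'
          by (intro exI [of _ 1] exI [of _ ?U]) auto
      qed
    qed
  qed
  ultimately show ?thesis
    by (simp add: admissible_def)
qed

end

lemma admissible_u: "admissible (u l)"
  by (induction l) (simp_all add: admissible_u0 admissible_step add_diff_eq [symmetric])

end

theorem proposition3:
  fixes h :: real
    and X :: "nat \<Rightarrow> (real ^ 'd) set"
    and T :: "nat \<Rightarrow> real ^ 'd \<Rightarrow> real ^ 'd"
    and \<mu> :: "(real ^ 'd) measure"
    and A :: "nat \<Rightarrow> real ^ 'd \<Rightarrow> real ^ 'd \<Rightarrow> real"
    and uN0 \<phi>N \<psi>N :: "nat \<Rightarrow> real ^ 'd \<Rightarrow> real"
    and u0 :: "real ^ 'd \<Rightarrow> real"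
    and \<Phi> \<Psi> \<Omega>0 :: "(real ^ 'd) set"
  assumes "h > 0"
    and "space_discretization h X T \<mu> A"
    and "\<And>N x. N \<ge> 1 \<Longrightarrow> x \<in> X N \<Longrightarrow> uN0 N x \<in> {- 1, 1}"
    and "\<And>N x. N \<ge> 1 \<Longrightarrow> x \<in> X N \<Longrightarrow> \<phi>N N x \<in> {- 1, 1}"
    and "\<And>N x. N \<ge> 1 \<Longrightarrow> x \<in> X N \<Longrightarrow> \<psi>N N x \<in> {- 1, 1}"
    and "\<And>x. x \<in> torus \<Longrightarrow> u0 x \<in> {- 1, 1}"
    and "\<Omega>0 = {x \<in> torus. u0 x = 1}"
    and "regular_domain \<Omega>0" and "regular_domain \<Phi>" and "regular_domain \<Psi>"
    and "\<Phi> \<subseteq> \<Omega>0" and "\<Psi> \<subseteq> torus - \<Omega>0"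
    and "L2_weakly_converges torus_measure (\<lambda>N. uN0 N \<circ> T N) u0"
    and "L2_weakly_converges torus_measure (\<lambda>N. \<phi>N N \<circ> T N) (inner_obstacle_fun \<Phi>)"
    and "L2_weakly_converges torus_measure (\<lambda>N. \<psi>N N \<circ> T N) (outer_obstacle_fun \<Psi>)"
  shows "\<exists>r. strict_mono r \<and>
    (\<forall>l. L2_weakly_converges torus_measure
       (\<lambda>n. discrete_mbo h (X (r n)) (A (r n)) (\<phi>N (r n)) (\<psi>N (r n)) (uN0 (r n)) l \<circ> T (r n))
       (continuous_mbo h \<Phi> \<Psi> u0 l))"
proof -
  note disc = assms(2) [unfolded space_discretization_def]
  have u0: "\<bar>u0 x\<bar> = 1" if "x \<in> torus" for x
    using assms(6) [OF that] by auto
  have sub: "\<Phi> \<subseteq> torus" "\<Psi> \<subseteq> torus"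
    using assms(9,10) by (auto simp: regular_domain_def)
  interpret obstacle_scheme h \<Phi> \<Psi> u0
  proof
    show "u0 x = - 1" if "x \<in> \<Psi>" for x
      using that assms(6) [of x] assms(7,12) by auto
  qed (use assms sub u0 in \<open>auto simp: regular_domain_def\<close>)
  interpret finite_measure "torus_measure :: (real ^ 'd) measure"
    by (rule finite_measure_torus)
  from disc have semigroup: "L2_converges torus_measure
      (\<lambda>N. discrete_semigroup h (X N) (A N) (vN N) \<circ> T N) (heat_semigroup h v)"
    if "L2_weakly_converges torus_measure (\<lambda>N. vN N \<circ> T N) v" for vN v
    using that by (elim conjE) simp
  have T: "T N x \<in> X N" if "N \<ge> 1" "x \<in> torus" for N x
  proof -
    have "T N \<in> measurable torus_measure (count_space (X N))"
      using disc that(1) by blast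
    from measurable_space [OF this, of x] that(2) show ?thesis
      by (simp add: space_torus_measure)
  qed
  have strong: "L2_converges torus_measure (\<lambda>N. f N \<circ> T N) f0"
    if "L2_weakly_converges torus_measure (\<lambda>N. f N \<circ> T N) f0"
      and "\<And>N x. N \<ge> 1 \<Longrightarrow> x \<in> X N \<Longrightarrow> f N x \<in> {- 1, 1}" and "\<And>x. x \<in> torus \<Longrightarrow> \<bar>f0 x\<bar> = 1" for f f0
  proof (rule L2_weakly_converges_sign_imp_converges [OF that(1)])
    have "\<bar>(f N \<circ> T N) x\<bar> = 1" if "N \<ge> 1" "x \<in> torus" for N x
      using \<open>\<And>N x. N \<ge> 1 \<Longrightarrow> x \<in> X N \<Longrightarrow> f N x \<in> {- 1, 1}\<close> [OF that(1) T [OF that]] by auto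
    then show "\<forall>\<^sub>F N in sequentially. \<forall>x\<in>space torus_measure. \<bar>(f N \<circ> T N) x\<bar> = 1"
      by (auto simp: space_torus_measure eventually_sequentially)
  qed (use that(3) in \<open>simp add: space_torus_measure\<close>)
  have \<phi>: "L2_converges torus_measure (\<lambda>N. \<phi>N N \<circ> T N) (inner_obstacle_fun \<Phi>)"
    by (rule strong [OF assms(14,4)]) (auto simp: inner_obstacle_fun_def)
  have \<psi>: "L2_converges torus_measure (\<lambda>N. \<psi>N N \<circ> T N) (outer_obstacle_fun \<Psi>)"
    by (rule strong [OF assms(15,5)]) (auto simp: outer_obstacle_fun_def)
  define d where "d N l = discrete_mbo h (X N) (A N) (\<phi>N N) (\<psi>N N) (uN0 N) l" for N l
  \<comment> \<open>The induction carries strong convergence, which the sign step requires; it is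
    weakened only to feed the hypothesis on the semigroups.\<close>
  have "L2_converges torus_measure (\<lambda>N. d N l \<circ> T N) (u l)" for l
  proof (induction l)
    case 0
    show ?case
      unfolding d_def discrete_mbo.simps continuous_mbo.simps
      by (rule strong [OF assms(13,3) u0])
  next
    case (Suc l)
    \<comment> \<open>The obstacle functions are \<open>2 * indicat_real \<Phi> x - 1\<close> and
      \<open>1 - 2 * indicat_real \<Psi> x\<close>, so the constants cancel in their mean. The
      discrete version needs the values to be 1 or -1.\<close>
    have half: "indicat_real \<Phi> x - indicat_real \<Psi> x =
        1 / 2 * inner_obstacle_fun \<Phi> x + 1 / 2 * outer_obstacle_fun \<Psi> x" for x
      by (simp add: inner_obstacle_fun_def outer_obstacle_fun_def)
    have half_N: "indicat_real {y \<in> X N. \<phi>N N y = 1} (T N x) - indicat_real {y \<in> X N. \<psi>N N y = - 1} (T N x) =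
        1 / 2 * \<phi>N N (T N x) + 1 / 2 * \<psi>N N (T N x)" if "N \<ge> 1" "x \<in> torus" for N x
      using assms(4,5) [OF that(1) T [OF that]] T [OF that] by (auto simp: indicator_def)
    have "L2_converges torus_measure
        (\<lambda>N. discrete_semigroup h (X N) (A N) (d N l) \<circ> T N) (heat_semigroup h (u l))"
      by (rule semigroup [OF L2_converges_imp_weakly [OF Suc.IH]])
    from L2_converges_add [OF this L2_converges_add [OF L2_converges_cmult [OF \<phi>] L2_converges_cmult [OF \<psi>]],
        of "1 / 2" "1 / 2"]
    have "L2_converges torus_measure
        (\<lambda>N x. mbo_sign ((discrete_semigroup h (X N) (A N) (d N l) \<circ> T N) x +
          (1 / 2 * (\<phi>N N \<circ> T N) x + 1 / 2 * (\<psi>N N \<circ> T N) x)))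
        (\<lambda>x. mbo_sign (heat_semigroup h (u l) x +
          (1 / 2 * inner_obstacle_fun \<Phi> x + 1 / 2 * outer_obstacle_fun \<Psi> x)))"
      using step_AE_nonzero [OF admissible_u, of l] by (intro mbo_sign_L2_converges) (simp_all only: half)
    then show ?case
    proof (rule L2_converges_cong)
      show "\<forall>\<^sub>F N in sequentially. \<forall>x\<in>space torus_measure.
          mbo_sign ((discrete_semigroup h (X N) (A N) (d N l) \<circ> T N) x +
            (1 / 2 * (\<phi>N N \<circ> T N) x + 1 / 2 * (\<psi>N N \<circ> T N) x)) = (d N (Suc l) \<circ> T N) x"
        \<comment> \<open>For \<open>N \<ge> 1\<close> the map \<open>T N\<close> takes values in
          \<open>X N\<close>, where the discrete obstacle functions are sign-valued.\<close>
        using eventually_ge_at_top [of 1]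
      proof eventually_elim
        case (elim N)
        then show ?case
          by (auto simp: space_torus_measure d_def add_diff_eq [symmetric] half_N simp del: times_divide_eq_left)
      qed
    qed (simp add: half add_diff_eq [symmetric])
  qed
  then have "L2_weakly_converges torus_measure (\<lambda>n. d n l \<circ> T n) (u l)" for l
    by (intro L2_converges_imp_weakly)
  then show ?thesis
    \<comment> \<open>The whole sequence converges, so the identity serves as the subsequence for
      all \<open>l\<close> at once.\<close>
    by (intro exI [of _ id]) (simp add: strict_mono_id d_def)
qed

end
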